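(* Let $p\in\mathbb C[z,w]$ be a non-zero homogeneous polynomial and let $d=\deg p(\cdot,1)$. Then $$\|X_{[p]}\|_{HS}^2\le\log\frac{\|p(\cdot,1)\|_2^2}{\mathfrak M(p(\cdot,1))^2}\le\log\binom{2d}{d}<2d\log 2.$$
   Context: $H^2(\mathbb D^2)$ is the Hardy space of the bidisc, $m$ is normalized Haar measure on $\mathbb T$, and $[p]$ is the closure of $p\,\mathbb C[z,w]$ in $H^2(\mathbb D^2)$. Here $p(\cdot,1)$ denotes the one-variable polynomial $\zeta\mapsto p(\zeta,1)$. With $R_z,R_w$ the restrictions to $[p]$ of multiplication by $z,w$, $X_{[p]}=R_z^*R_w-R_wR_z^*$. $\|\cdot\|_{HS}$ is the Hilbert--Schmidt norm, $\|q\|_2$ is the norm of $L^2(\mathbb T,m)$, and $\mathfrak M(q)=\exp\left(\int_{\mathbb T}\log|q|\,dm\right)$ is the Mahler measure.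
   Formalization: The last strict inequality log C(2d,d) < 2d log 2 is asserted only for d > 0, since for d = 0 (for example p = 1 or p = w^n) it would read 0 < 0; the other inequalities are stated for every d. *)

theory Defs
  imports "HOL-Complex_Analysis.Complex_Analysis" "HOL-Computational_Algebra.Polynomial"
begin

section \<open>The Hardy space of the bidisc\<close>

definition bidisc :: "(complex \<times> complex) set" where
  "bidisc = ball 0 1 \<times> ball 0 1"

definition monomial2 :: "nat \<times> nat \<Rightarrow> complex \<times> complex \<Rightarrow> complex" where
  "monomial2 k x = fst x ^ fst k * snd x ^ snd k"

definition square_summable :: "(nat \<times> nat \<Rightarrow> complex) \<Rightarrow> bool" where
  "square_summable a \<longleftrightarrow> (\<lambda>k. (cmod (a k))\<^sup>2) summable_on UNIV"

text \<open>Functions on the bidisc are represented by their extension by zero, so that equality of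
  elements is equality of functions on the bidisc.\<close>

definition power_series2 :: "(nat \<times> nat \<Rightarrow> complex) \<Rightarrow> complex \<times> complex \<Rightarrow> complex" where
  "power_series2 a x = (if x \<in> bidisc then \<Sum>\<^sub>\<infinity>k. a k * monomial2 k x else 0)"

typedef hardy2 = "power_series2 ` {a. square_summable a}"
proof -
  have "power_series2 (\<lambda>_. 0) \<in> power_series2 ` {a. square_summable a}"
    by (auto simp: square_summable_def)
  then show ?thesis by blast
qed

setup_lifting type_definition_hardy2

lemma prod_le_sum_squares: "x * y \<le> x\<^sup>2 + y\<^sup>2" for x y :: real
proof -
  have "0 \<le> (x - y)\<^sup>2" "0 \<le> (x + y)\<^sup>2" "0 \<le> x\<^sup>2" "0 \<le> y\<^sup>2" by simp_all
  then show ?thesis unfolding power2_diff power2_sum by linarith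
qed

lemma abs_summable_mult_square_summable:
  assumes "square_summable a" "square_summable b"
  shows "(\<lambda>k. norm (a k * b k)) summable_on UNIV"
proof (rule Infinite_Sum.abs_summable_on_comparison_test')
  show "(\<lambda>k. (cmod (a k))\<^sup>2 + (cmod (b k))\<^sup>2) summable_on UNIV"
    using assms unfolding square_summable_def by (rule summable_on_add)
  show "norm (a k * b k) \<le> (cmod (a k))\<^sup>2 + (cmod (b k))\<^sup>2" for k
    using prod_le_sum_squares by (simp add: norm_mult)
qed

lemma square_summable_cnj: "square_summable a \<Longrightarrow> square_summable (\<lambda>k. cnj (a k))"
  by (simp add: square_summable_def)

lemma square_summable_add:
  assumes "square_summable a" "square_summable b"
  shows "square_summable (\<lambda>k. a k + b k)"
  unfolding square_summable_def
proof (rule summable_on_comparison_test)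
  show "(\<lambda>k. 2 * ((cmod (a k))\<^sup>2 + (cmod (b k))\<^sup>2)) summable_on UNIV"
    using assms unfolding square_summable_def by (intro summable_on_cmult_right summable_on_add)
  fix k
  have "(cmod (a k + b k))\<^sup>2 \<le> (cmod (a k) + cmod (b k))\<^sup>2"
    by (intro power_mono norm_triangle_ineq) auto
  also have "\<dots> \<le> 2 * ((cmod (a k))\<^sup>2 + (cmod (b k))\<^sup>2)"
    using zero_le_power2[of "cmod (a k) - cmod (b k)"] by (simp add: power2_sum power2_diff)
  finally show "(cmod (a k + b k))\<^sup>2 \<le> 2 * ((cmod (a k))\<^sup>2 + (cmod (b k))\<^sup>2)" .
qed auto

lemma square_summable_cmult: "square_summable a \<Longrightarrow> square_summable (\<lambda>k. c * a k)"
  unfolding square_summable_def norm_mult power_mult_distrib by (rule summable_on_cmult_right)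

lemma square_summable_monomial2:
  assumes "x \<in> bidisc"
  shows "square_summable (\<lambda>k. monomial2 k x)"
proof -
  obtain z w where x: "x = (z, w)" by (cases x)
  have zw: "(cmod z)\<^sup>2 < 1" "(cmod w)\<^sup>2 < 1"
    using assms by (auto simp: x bidisc_def abs_square_less_1)
  have geo: "(\<lambda>n. ((cmod u)\<^sup>2) ^ n) summable_on UNIV" if "(cmod u)\<^sup>2 < 1" for u
    using that by (intro norm_summable_imp_summable_on) (simp add: summable_geometric)
  have "(\<lambda>(m, n). ((cmod z)\<^sup>2) ^ m * ((cmod w)\<^sup>2) ^ n) summable_on (UNIV \<times> UNIV)"
  proof (rule summable_on_SigmaI)
    show "((\<lambda>n. case (m, n) of (m, n) \<Rightarrow> ((cmod z)\<^sup>2) ^ m * ((cmod w)\<^sup>2) ^ n) has_sum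
        ((cmod z)\<^sup>2) ^ m * (\<Sum>\<^sub>\<infinity>n. ((cmod w)\<^sup>2) ^ n)) UNIV" for m
      using has_sum_cmult_right[OF has_sum_infsum[OF geo[OF zw(2)]]] by simp
    show "(\<lambda>m. ((cmod z)\<^sup>2) ^ m * (\<Sum>\<^sub>\<infinity>n. ((cmod w)\<^sup>2) ^ n)) summable_on UNIV"
      by (intro summable_on_cmult_left geo zw)
  qed auto
  moreover have "(cmod (monomial2 k x))\<^sup>2 = (case k of (m, n) \<Rightarrow> ((cmod z)\<^sup>2) ^ m * ((cmod w)\<^sup>2) ^ n)" for k
    by (simp add: monomial2_def x norm_mult norm_power power_mult_distrib case_prod_unfold
        flip: power_mult) (simp add: mult.commute)
  ultimately show ?thesis by (simp add: square_summable_def)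
qed

lemma has_sum_power_series2:
  assumes "square_summable a" "x \<in> bidisc"
  shows "((\<lambda>k. a k * monomial2 k x) has_sum power_series2 a x) UNIV"
  using abs_summable_summable[OF abs_summable_mult_square_summable[OF assms(1) square_summable_monomial2[OF assms(2)]]]
    assms(2) by (simp add: power_series2_def)

lemma power_series2_eqI:
  assumes "\<And>x. x \<in> bidisc \<Longrightarrow> ((\<lambda>k. a k * monomial2 k x) has_sum f x) UNIV"
    "\<And>x. x \<notin> bidisc \<Longrightarrow> f x = 0"
  shows "f = power_series2 a"
proof
  show "f x = power_series2 a x" for x
    using assms infsumI[OF assms(1), of x] by (cases "x \<in> bidisc") (simp_all add: power_series2_def)
qed

lemma powser_zero_imp_coeff_zero:
  fixes a :: "nat \<Rightarrow> complex"
  assumes "\<And>z. cmod z < 1 \<Longrightarrow> ((\<lambda>n. a n * z ^ n) has_sum 0) UNIV"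
  shows "a n = 0"
proof -
  have s: "(\<lambda>n. a n * (z - 0) ^ n) sums 0" if "norm (z - 0) < 1" for z
    using has_sum_imp_sums[OF assms] that by simp
  show ?thesis
  proof (cases "n = 0")
    case True
    then show ?thesis using s[of 0] by simp
  next
    case False
    then have "0 < n" by simp
    show ?thesis
    proof (rule ccontr)
      assume "a n \<noteq> 0"
      obtain r where "0 < r" "\<And>z::complex. z \<in> cball 0 r - {0} \<Longrightarrow> (0::complex) \<noteq> 0"
        by (rule powser_0_nonzero[where r = 1 and a = a and \<xi> = 0 and f = "\<lambda>_. 0" and m = n,
              OF zero_less_one s refl \<open>a n \<noteq> 0\<close> \<open>0 < n\<close>]) (assumption, rule that)
      moreover have "of_real r \<in> cball (0::complex) r - {0}" using \<open>0 < r\<close> by simp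
      ultimately show False by blast
    qed
  qed
qed

lemma power_series2_zero_imp:
  assumes a: "square_summable a" and zero: "\<And>x. power_series2 a x = 0"
  shows "a k = 0"
proof -
  have sum2: "((\<lambda>(m, n). a (m, n) * z ^ m * w ^ n) has_sum 0) (UNIV \<times> UNIV)"
    and abs2: "(\<lambda>n. a (m, n) * w ^ n) summable_on UNIV"
    if "cmod z < 1" "cmod w < 1" for z w m
  proof -
    have 1: "(z, w) \<in> bidisc" using that by (simp add: bidisc_def)
    show "((\<lambda>(m, n). a (m, n) * z ^ m * w ^ n) has_sum 0) (UNIV \<times> UNIV)"
      using has_sum_power_series2[OF a 1] zero
      by (simp add: monomial2_def case_prod_unfold mult.assoc)
    have "(1/2, w) \<in> bidisc" using that by (simp add: bidisc_def)
    then have "(\<lambda>k. a k * monomial2 k (1/2, w)) summable_on (UNIV \<times> UNIV)"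
      using has_sum_power_series2[OF a] by (auto intro: has_sum_imp_summable)
    then have "(\<lambda>n. a (m, n) * monomial2 (m, n) (1/2, w)) summable_on UNIV"
      using summable_on_SigmaD1[of "\<lambda>m n. a (m, n) * monomial2 (m, n) (1/2, w)" UNIV "\<lambda>_. UNIV" m]
      by (simp add: case_prod_unfold)
    then have "(\<lambda>n. 2 ^ m * (a (m, n) * monomial2 (m, n) (1/2, w))) summable_on UNIV"
      by (rule summable_on_cmult_right)
    then show "(\<lambda>n. a (m, n) * w ^ n) summable_on UNIV"
      by (simp add: monomial2_def power_divide)
  qed
  define g where "g w m = (\<Sum>\<^sub>\<infinity>n. a (m, n) * w ^ n)" for w m
  have g0: "g w m = 0" if w: "cmod w < 1" for w m
  proof (rule powser_zero_imp_coeff_zero[of "g w"])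
    fix z :: complex assume z: "cmod z < 1"
    have "((\<lambda>n. a (m, n) * z ^ m * w ^ n) has_sum g w m * z ^ m) UNIV" for m
      using has_sum_cmult_right[OF has_sum_infsum[OF abs2[OF z w, of m]], of "z ^ m"]
      by (simp add: g_def mult_ac)
    then show "((\<lambda>m. g w m * z ^ m) has_sum 0) UNIV"
      by (intro has_sum_SigmaD[OF sum2[OF z w]]) auto
  qed
  obtain m n where k: "k = (m, n)" by (cases k)
  have "a (m, n) = 0"
  proof (rule powser_zero_imp_coeff_zero[of "\<lambda>n. a (m, n)"])
    fix w :: complex assume w: "cmod w < 1"
    show "((\<lambda>n. a (m, n) * w ^ n) has_sum 0) UNIV"
      using has_sum_infsum[OF abs2[of 0 w m]] g0[OF w, of m] w by (simp add: g_def)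
  qed
  then show ?thesis by (simp add: k)
qed

lemma power_series2_add:
  assumes "square_summable a" "square_summable b"
  shows "power_series2 (\<lambda>k. a k + b k) = (\<lambda>x. power_series2 a x + power_series2 b x)"
proof (rule power_series2_eqI[symmetric])
  fix x assume "x \<in> bidisc"
  then show "((\<lambda>k. (a k + b k) * monomial2 k x) has_sum power_series2 a x + power_series2 b x) UNIV"
    unfolding distrib_right by (intro has_sum_add has_sum_power_series2 assms)
qed (simp add: power_series2_def)

lemma power_series2_cmult:
  assumes "square_summable a"
  shows "power_series2 (\<lambda>k. c * a k) = (\<lambda>x. c * power_series2 a x)"
proof (rule power_series2_eqI[symmetric])
  fix x assume "x \<in> bidisc"
  then show "((\<lambda>k. c * a k * monomial2 k x) has_sum c * power_series2 a x) UNIV"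
    unfolding mult.assoc by (intro has_sum_cmult_right has_sum_power_series2 assms)
qed (simp add: power_series2_def)

lemma power_series2_inj:
  assumes "square_summable a" "square_summable b" "power_series2 a = power_series2 b"
  shows "a = b"
proof
  fix k
  have b: "square_summable (\<lambda>k. - 1 * b k)" by (intro square_summable_cmult assms)
  have "power_series2 (\<lambda>k. a k + - 1 * b k) x = 0" for x
    unfolding power_series2_add[OF assms(1) b] power_series2_cmult[OF assms(2)]
    by (simp add: assms(3))
  then have "a k + - 1 * b k = 0"
    by (rule power_series2_zero_imp[OF square_summable_add[OF assms(1) b]])
  then show "a k = b k" by simp
qed

definition hcoeff :: "hardy2 \<Rightarrow> nat \<times> nat \<Rightarrow> complex" where
  "hcoeff f = (THE a. square_summable a \<and> Rep_hardy2 f = power_series2 a)"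

lemma hcoeff_eqI:
  assumes "square_summable a" "Rep_hardy2 f = power_series2 a"
  shows "hcoeff f = a"
  unfolding hcoeff_def using assms by (intro the_equality) (auto intro: power_series2_inj)

lemma square_summable_hcoeff: "square_summable (hcoeff f)"
  and Rep_hardy2_hcoeff: "Rep_hardy2 f = power_series2 (hcoeff f)"
proof -
  obtain a where "square_summable a" "Rep_hardy2 f = power_series2 a"
    using Rep_hardy2[of f] by blast
  then show "square_summable (hcoeff f)" "Rep_hardy2 f = power_series2 (hcoeff f)"
    using hcoeff_eqI by metis+
qed

lemma hardy2_eqI: "hcoeff f = hcoeff g \<Longrightarrow> f = g"
  by (metis Rep_hardy2_hcoeff Rep_hardy2_inject)

lemma hardy2_memI: "square_summable a \<Longrightarrow> f = power_series2 a \<Longrightarrow> f \<in> power_series2 ` {a. square_summable a}"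
  by auto

lift_definition hardy_mult :: "complex \<Rightarrow> hardy2 \<Rightarrow> hardy2" is "\<lambda>c f x. c * f x"
  by (auto simp flip: power_series2_cmult intro!: imageI square_summable_cmult)

instantiation hardy2 :: real_vector
begin

lift_definition zero_hardy2 :: hardy2 is "\<lambda>_. 0"
  by (rule hardy2_memI[of "\<lambda>_. 0"]) (auto simp: square_summable_def power_series2_def)

lift_definition plus_hardy2 :: "hardy2 \<Rightarrow> hardy2 \<Rightarrow> hardy2" is "\<lambda>f g x. f x + g x"
  by (auto simp flip: power_series2_add intro!: imageI square_summable_add)

lift_definition uminus_hardy2 :: "hardy2 \<Rightarrow> hardy2" is "\<lambda>f x. - f x"
proof -
  fix f :: "complex \<times> complex \<Rightarrow> complex"
  assume "f \<in> power_series2 ` {a. square_summable a}"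
  then obtain a where a: "square_summable a" "f = power_series2 a" by auto
  then show "(\<lambda>x. - f x) \<in> power_series2 ` {a. square_summable a}"
    using power_series2_cmult[OF a(1), of "- 1"]
    by (intro hardy2_memI[OF square_summable_cmult[OF a(1), of "- 1"]]) simp
qed

definition minus_hardy2 :: "hardy2 \<Rightarrow> hardy2 \<Rightarrow> hardy2" where
  "minus_hardy2 f g = f + (- g)"

definition scaleR_hardy2 :: "real \<Rightarrow> hardy2 \<Rightarrow> hardy2" where
  "scaleR_hardy2 r f = hardy_mult (complex_of_real r) f"

instance
  by (standard; (unfold minus_hardy2_def scaleR_hardy2_def)?; transfer;
      simp add: algebra_simps fun_eq_iff)

end

lemma hcoeff_add: "hcoeff (f + g) = (\<lambda>k. hcoeff f k + hcoeff g k)"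
  by (intro hcoeff_eqI square_summable_add square_summable_hcoeff)
    (simp only: plus_hardy2.rep_eq power_series2_add[OF square_summable_hcoeff square_summable_hcoeff]
        Rep_hardy2_hcoeff[symmetric])

lemma hcoeff_hardy_mult: "hcoeff (hardy_mult c f) = (\<lambda>k. c * hcoeff f k)"
  by (intro hcoeff_eqI square_summable_cmult square_summable_hcoeff)
    (simp only: hardy_mult.rep_eq power_series2_cmult[OF square_summable_hcoeff]
        Rep_hardy2_hcoeff[symmetric])

lemma hcoeff_scaleR: "hcoeff (r *\<^sub>R f) = (\<lambda>k. of_real r * hcoeff f k)"
  by (simp add: scaleR_hardy2_def hcoeff_hardy_mult)

lemma hcoeff_zero: "hcoeff 0 = (\<lambda>_. 0)"
  by (rule hcoeff_eqI) (auto simp: square_summable_def zero_hardy2.rep_eq power_series2_def)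

definition cip :: "hardy2 \<Rightarrow> hardy2 \<Rightarrow> complex" where
  "cip f g = (\<Sum>\<^sub>\<infinity>k. hcoeff f k * cnj (hcoeff g k))"

lemma has_sum_cip: "((\<lambda>k. hcoeff f k * cnj (hcoeff g k)) has_sum cip f g) UNIV"
  unfolding cip_def
  by (rule has_sum_infsum[OF abs_summable_summable[OF abs_summable_mult_square_summable[OF
      square_summable_hcoeff square_summable_cnj[OF square_summable_hcoeff]]]])

lemma cip_commute: "cip f g = cnj (cip g f)"
proof (rule has_sum_unique[OF has_sum_cip])
  have eq: "cnj (x * cnj y) = y * cnj x" for x y by simp
  show "((\<lambda>k. hcoeff f k * cnj (hcoeff g k)) has_sum cnj (cip g f)) UNIV"
    using has_sum_cip[of g f] unfolding has_sum_cnj_iff[of "\<lambda>k. hcoeff g k * cnj (hcoeff f k)", symmetric] eq .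
qed

lemma cip_add_left: "cip (f + g) h = cip f h + cip g h"
  by (rule has_sum_unique[OF has_sum_cip])
    (use has_sum_add[OF has_sum_cip[of f h] has_sum_cip[of g h]] in
      \<open>simp add: hcoeff_add distrib_right\<close>)

lemma cip_hardy_mult_left: "cip (hardy_mult c f) g = c * cip f g"
  by (rule has_sum_unique[OF has_sum_cip])
    (use has_sum_cmult_right[OF has_sum_cip[of f g], of c] in
      \<open>simp add: hcoeff_hardy_mult mult.assoc\<close>)

lemma has_sum_cip_self: "((\<lambda>k. (cmod (hcoeff f k))\<^sup>2) has_sum Re (cip f f)) UNIV"
proof -
  have "Re (c * cnj c) = (cmod c)\<^sup>2" for c
    unfolding complex_norm_square[symmetric] by (rule Re_complex_of_real)
  then show ?thesis using has_sum_Re[OF has_sum_cip[of f f]] by simp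
qed

instantiation hardy2 :: real_inner
begin

definition inner_hardy2 :: "hardy2 \<Rightarrow> hardy2 \<Rightarrow> real" where
  "inner_hardy2 f g = Re (cip f g)"

definition norm_hardy2 :: "hardy2 \<Rightarrow> real" where
  "norm_hardy2 f = sqrt (inner f f)"

definition dist_hardy2 :: "hardy2 \<Rightarrow> hardy2 \<Rightarrow> real" where
  "dist_hardy2 f g = norm (f - g)"

definition sgn_hardy2 :: "hardy2 \<Rightarrow> hardy2" where
  "sgn_hardy2 f = f /\<^sub>R norm f"

definition uniformity_hardy2 :: "(hardy2 \<times> hardy2) filter" where
  "uniformity_hardy2 = (INF e\<in>{0 <..}. principal {(x, y). dist x y < e})"

definition open_hardy2 :: "hardy2 set \<Rightarrow> bool" where
  "open_hardy2 U \<longleftrightarrow> (\<forall>x\<in>U. eventually (\<lambda>(x', y). x' = x \<longrightarrow> y \<in> U) uniformity)"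

instance
proof
  fix f g h :: hardy2 and r :: real
  show "inner f g = inner g f"
    unfolding inner_hardy2_def by (subst cip_commute) simp
  show "inner (f + g) h = inner f h + inner g h"
    by (simp add: inner_hardy2_def cip_add_left)
  show "inner (r *\<^sub>R f) g = r * inner f g"
    by (simp add: inner_hardy2_def scaleR_hardy2_def cip_hardy_mult_left)
  show "0 \<le> inner f f"
    unfolding inner_hardy2_def using has_sum_nonneg[OF has_sum_cip_self[of f]] by simp
  show "inner f f = 0 \<longleftrightarrow> f = 0"
  proof
    assume "inner f f = 0"
    then have "((\<lambda>k. (cmod (hcoeff f k))\<^sup>2) has_sum 0) UNIV"
      using has_sum_cip_self[of f] by (simp add: inner_hardy2_def)
    then have "(cmod (hcoeff f k))\<^sup>2 = 0" for k
      using nonneg_has_sum_le_0D[of "\<lambda>k. (cmod (hcoeff f k))\<^sup>2" UNIV 0 k] by simp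
    then show "f = 0" by (intro hardy2_eqI) (simp add: hcoeff_zero fun_eq_iff)
  qed (simp add: inner_hardy2_def cip_def hcoeff_zero)
qed (simp_all add: norm_hardy2_def dist_hardy2_def sgn_hardy2_def uniformity_hardy2_def open_hardy2_def)

end

lemma norm_hardy2_squared: "(norm f)\<^sup>2 = (\<Sum>\<^sub>\<infinity>k. (cmod (hcoeff f k))\<^sup>2)"
  unfolding infsumI[OF has_sum_cip_self[of f]] power2_norm_eq_inner[of f] inner_hardy2_def ..

lemma power_series2_shift:
  assumes a: "square_summable a" and h: "inj h"
    and c: "\<And>k x. x \<in> bidisc \<Longrightarrow> monomial2 (h k) x = c x * monomial2 k x"
  shows "(\<lambda>x. c x * power_series2 a x) \<in> power_series2 ` {a. square_summable a}"
proof -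
  define b where "b k = (if k \<in> range h then a (inv h k) else 0)" for k
  have bh: "b (h k) = a k" for k using h by (simp add: b_def)
  have sum_iff: "((\<lambda>k. u (b k) k) has_sum s) UNIV \<longleftrightarrow> ((\<lambda>k. u (a k) (h k)) has_sum s) UNIV"
    if "\<And>k. u 0 k = 0" for u :: "complex \<Rightarrow> nat \<times> nat \<Rightarrow> 'b::{comm_monoid_add,topological_space}" and s
  proof -
    have "((\<lambda>k. u (b k) k) has_sum s) UNIV \<longleftrightarrow> ((\<lambda>k. u (b k) k) has_sum s) (range h)"
      by (intro has_sum_cong_neutral) (auto simp: b_def that)
    also have "\<dots> \<longleftrightarrow> ((\<lambda>k. u (a k) (h k)) has_sum s) UNIV"
      by (subst has_sum_reindex[OF h]) (simp add: o_def bh)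
    finally show ?thesis .
  qed
  have "square_summable b"
    using a sum_iff[of "\<lambda>v k. (cmod v)\<^sup>2"] by (auto simp: square_summable_def summable_on_def)
  moreover have "(\<lambda>x. c x * power_series2 a x) = power_series2 b"
  proof (rule power_series2_eqI)
    fix x assume x: "x \<in> bidisc"
    have "((\<lambda>k. a k * monomial2 (h k) x) has_sum c x * power_series2 a x) UNIV"
      using has_sum_cmult_right[OF has_sum_power_series2[OF a x], of "c x"] c[OF x]
      by (simp add: mult_ac)
    then show "((\<lambda>k. b k * monomial2 k x) has_sum c x * power_series2 a x) UNIV"
      using sum_iff[of "\<lambda>v k. v * monomial2 k x"] by simp
  qed (simp add: power_series2_def)
  ultimately show ?thesis by blast
qed

lift_definition mult_z :: "hardy2 \<Rightarrow> hardy2" is "\<lambda>f x. fst x * f x"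
proof -
  fix f assume "f \<in> power_series2 ` {a. square_summable a}"
  then obtain a where a: "square_summable a" "f = power_series2 a" by blast
  have "inj (\<lambda>k :: nat \<times> nat. (Suc (fst k), snd k))" by (simp add: inj_def prod_eq_iff)
  then show "(\<lambda>x. fst x * f x) \<in> power_series2 ` {a. square_summable a}"
    unfolding a(2) by (rule power_series2_shift[OF a(1)]) (simp add: monomial2_def)
qed

lift_definition mult_w :: "hardy2 \<Rightarrow> hardy2" is "\<lambda>f x. snd x * f x"
proof -
  fix f assume "f \<in> power_series2 ` {a. square_summable a}"
  then obtain a where a: "square_summable a" "f = power_series2 a" by blast
  have "inj (\<lambda>k :: nat \<times> nat. (fst k, Suc (snd k)))" by (simp add: inj_def prod_eq_iff)
  then show "(\<lambda>x. snd x * f x) \<in> power_series2 ` {a. square_summable a}"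
    unfolding a(2) by (rule power_series2_shift[OF a(1)]) (simp add: monomial2_def)
qed


section \<open>Polynomials in two variables\<close>

text \<open>The outer variable of a \<^typ>\<open>complex poly poly\<close> is \<open>z\<close>, the inner one is \<open>w\<close>: the
  coefficient of \<open>z ^ i * w ^ j\<close> in \<open>p\<close> is \<^term>\<open>coeff (coeff p i) j\<close>.\<close>

definition poly_zw :: "complex poly poly \<Rightarrow> complex \<Rightarrow> complex \<Rightarrow> complex" where
  "poly_zw p z w = poly (poly p [:z:]) w"

definition homogeneous :: "complex poly poly \<Rightarrow> bool" where
  "homogeneous p \<longleftrightarrow> (\<exists>n. \<forall>i j. coeff (coeff p i) j \<noteq> 0 \<longrightarrow> i + j = n)"

definition poly_at_w1 :: "complex poly poly \<Rightarrow> complex poly" where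
  "poly_at_w1 p = map_poly (\<lambda>c. poly c 1) p"

lemma poly_poly_at_w1: "poly (poly_at_w1 p) z = poly_zw p z 1"
  by (induction p) (auto simp: poly_at_w1_def poly_zw_def map_poly_pCons)

lemma poly_zw_sum:
  "poly_zw p z w = (\<Sum>(i, j)\<in>(SIGMA i:{..degree p}. {..degree (coeff p i)}). coeff (coeff p i) j * (z ^ i * w ^ j))"
proof -
  have "poly_zw p z w = (\<Sum>i\<le>degree p. poly (coeff p i) w * z ^ i)"
    unfolding poly_zw_def poly_altdef[of p "[:z:]"] poly_sum poly_mult poly_power by simp
  also have "\<dots> = (\<Sum>i\<le>degree p. \<Sum>j\<le>degree (coeff p i). coeff (coeff p i) j * (z ^ i * w ^ j))"
    unfolding poly_altdef[of _ w] sum_distrib_right by (intro sum.cong refl) (simp add: mult_ac)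
  also have "\<dots> = (\<Sum>(i, j)\<in>(SIGMA i:{..degree p}. {..degree (coeff p i)}). coeff (coeff p i) j * (z ^ i * w ^ j))"
    by (rule sum.Sigma) auto
  finally show ?thesis .
qed

lift_definition hardy_of_poly :: "complex poly poly \<Rightarrow> hardy2" is
  "\<lambda>p x. if x \<in> bidisc then poly_zw p (fst x) (snd x) else 0"
proof -
  fix p :: "complex poly poly"
  define S where "S = (SIGMA i:{..degree p}. {..degree (coeff p i)})"
  define a where "a = (\<lambda>(i, j). coeff (coeff p i) j)"
  have S: "finite S" by (simp add: S_def)
  have a0: "a k = 0" if "k \<notin> S" for k
    using that by (cases k) (auto simp: a_def S_def not_le coeff_eq_0)
  have "square_summable a"
    unfolding square_summable_def
    by (rule has_sum_imp_summable, rule has_sum_finite_neutralI[OF S subset_UNIV _ refl]) (simp add: a0)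
  moreover have "(\<lambda>x. if x \<in> bidisc then poly_zw p (fst x) (snd x) else 0) = power_series2 a"
  proof (rule power_series2_eqI)
    fix x assume "x \<in> bidisc"
    then have "(if x \<in> bidisc then poly_zw p (fst x) (snd x) else 0) = (\<Sum>k\<in>S. a k * monomial2 k x)"
      by (simp add: poly_zw_sum a_def monomial2_def S_def case_prod_unfold)
    then show "((\<lambda>k. a k * monomial2 k x) has_sum (if x \<in> bidisc then poly_zw p (fst x) (snd x) else 0)) UNIV"
      by (intro has_sum_finite_neutralI[OF S subset_UNIV]) (simp_all add: a0)
  qed simp
  ultimately show "(\<lambda>x. if x \<in> bidisc then poly_zw p (fst x) (snd x) else 0) \<in> power_series2 ` {a. square_summable a}"
    by (rule hardy2_memI)
qed

definition principal_submodule :: "complex poly poly \<Rightarrow> hardy2 set" where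
  "principal_submodule p = closure (range (\<lambda>r. hardy_of_poly (p * r)))"


section \<open>Operators on a closed subspace\<close>

text \<open>An operator on a closed subspace \<open>M\<close> is given by a map on \<^typ>\<open>hardy2\<close> of which only the
  values on \<open>M\<close> matter. The adjoint is taken in the Hilbert space \<open>M\<close>.\<close>

definition adjoint_on :: "hardy2 set \<Rightarrow> (hardy2 \<Rightarrow> hardy2) \<Rightarrow> hardy2 \<Rightarrow> hardy2" where
  "adjoint_on M T g = (THE h. h \<in> M \<and> (\<forall>f\<in>M. cip (T f) g = cip f h))"

definition cross_commutator :: "hardy2 set \<Rightarrow> hardy2 \<Rightarrow> hardy2" where
  "cross_commutator M f = adjoint_on M mult_z (mult_w f) - mult_w (adjoint_on M mult_z f)"

definition orthonormal_basis_of :: "hardy2 set \<Rightarrow> hardy2 set \<Rightarrow> bool" where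
  "orthonormal_basis_of M B \<longleftrightarrow>
     B \<subseteq> M \<and> (\<forall>e\<in>B. \<forall>e'\<in>B. cip e e' = (if e = e' then 1 else 0)) \<and>
     (\<forall>f\<in>M. (\<forall>e\<in>B. cip f e = 0) \<longrightarrow> f = 0)"

definition hilbert_schmidt_on :: "hardy2 set \<Rightarrow> (hardy2 \<Rightarrow> hardy2) \<Rightarrow> bool" where
  "hilbert_schmidt_on M T \<longleftrightarrow>
     (\<exists>B. orthonormal_basis_of M B \<and> (\<lambda>e. (norm (T e))\<^sup>2) summable_on B)"

text \<open>For a Hilbert--Schmidt operator the sum does not depend on the orthonormal basis.\<close>

definition hs_norm_on :: "hardy2 set \<Rightarrow> (hardy2 \<Rightarrow> hardy2) \<Rightarrow> real" where
  "hs_norm_on M T = sqrt (\<Sum>\<^sub>\<infinity>e\<in>(SOME B. orthonormal_basis_of M B). (norm (T e))\<^sup>2)"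


section \<open>Norm and Mahler measure on the circle\<close>

definition haar_circle :: "complex measure" where
  "haar_circle = distr (uniform_measure lborel {0..2 * pi}) borel cis"

definition circle_norm2 :: "complex poly \<Rightarrow> real" where
  "circle_norm2 q = sqrt (\<integral>\<zeta>. (cmod (poly q \<zeta>))\<^sup>2 \<partial>haar_circle)"

text \<open>For \<open>q \<noteq> 0\<close> the finitely many zeros of \<open>q\<close> form a null set, on which the convention
  \<open>ln 0 = 0\<close> is harmless.\<close>

definition mahler_measure :: "complex poly \<Rightarrow> real" where
  "mahler_measure q = exp (\<integral>\<zeta>. ln (cmod (poly q \<zeta>)) \<partial>haar_circle)"

end

theory Submission
  imports Defs "HOL-Computational_Algebra.Fundamental_Theorem_Algebra"
begin

text \<open>Write \<open>q = p(\<cdot>, 1)\<close> and let \<open>N\<close> be the degree of \<open>p\<close>. Restriction to \<open>w = 1\<close> identifies the part of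
  \<open>[p]\<close> of degree \<open>N + n\<close> with \<open>q\<close> times the polynomials of degree at most \<open>n\<close>, normed by
  \<open>L\<^sup>2(\<bar>q\<bar>\<^sup>2 dm)\<close> on the latter; multiplication by \<open>z\<close> becomes multiplication by the variable and
  multiplication by \<open>w\<close> becomes inclusion. Let \<open>\<Phi>\<^sub>n\<close> correspond to the monic orthogonal polynomial of
  degree \<open>n\<close>. The \<open>\<Phi>\<^sub>n\<close> form an orthogonal basis of \<open>[p] \<ominus> w[p]\<close>, and
  \<open>z \<Phi>\<^sub>n = w \<Psi>\<^sub>n + \<Phi>\<^sub>n\<^sub>+\<^sub>1\<close> orthogonally, with \<open>\<Psi>\<^sub>n \<in> [p]\<close>. The cross commutator \<open>X\<close> maps into
  \<open>[p] \<ominus> w[p]\<close> and \<open>\<langle>X f, \<Phi>\<^sub>n\<rangle> = \<langle>f, \<Psi>\<^sub>n\<rangle>\<close>, so by Parseval and Bessel its squared Hilbert--Schmidt norm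
  is at most \<open>\<Sum>\<^sub>n (1 - x\<^sub>n)\<close> with \<open>x\<^sub>n = \<parallel>\<Phi>\<^sub>n\<^sub>+\<^sub>1\<parallel>\<^sup>2 / \<parallel>\<Phi>\<^sub>n\<parallel>\<^sup>2\<close>. As \<open>1 - x \<le> - log x\<close>, this telescopes, and
  \<open>\<parallel>\<Phi>\<^sub>n\<parallel>\<close> never drops below the Mahler measure of \<open>q\<close>, since that of a monic polynomial is at least 1.

  For the second inequality, the \<open>i\<close>-th coefficient of \<open>q\<close> is at most \<open>d choose i\<close> times the Mahler measure.
  The mean of \<open>log \<bar>\<zeta> - a\<bar>\<close> over the circle, for \<open>\<bar>a\<bar> \<le> 1\<close>, doubles when \<open>a\<close> is replaced by \<open>a\<^sup>2\<close> (factor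
  \<open>\<zeta>\<^sup>2 - a\<^sup>2\<close>) and stays bounded, so it vanishes.\<close>

section \<open>Mahler measure and the norm on the circle\<close>

lemma sets_haar_circle [simp, measurable_cong]: "sets haar_circle = sets borel"
  by (simp add: haar_circle_def)

lemma space_haar_circle [simp]: "space haar_circle = UNIV"
  by (simp add: haar_circle_def)

lemma borel_measurable_cis [measurable]: "cis \<in> borel_measurable borel"
  by (intro borel_measurable_continuous_onI continuous_intros)

text \<open>The endpoint 2 pi is a null set, so the closed interval of the definition gives way to a
  half-open one, whose translates by 2 pi tile the line.\<close>

lemma nn_integral_haar_circle:
  assumes [measurable]: "f \<in> borel_measurable borel"
  shows "(\<integral>\<^sup>+\<zeta>. f \<zeta> \<partial>haar_circle) =
    (\<integral>\<^sup>+x. f (cis x) * indicator {0..<2 * pi} x \<partial>lborel) / ennreal (2 * pi)"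
proof -
  have "(\<integral>\<^sup>+\<zeta>. f \<zeta> \<partial>haar_circle) = (\<integral>\<^sup>+x. f (cis x) \<partial>uniform_measure lborel {0..2 * pi})"
    unfolding haar_circle_def by (rule nn_integral_distr) simp_all
  also have "\<dots> = (\<integral>\<^sup>+x. f (cis x) * indicator {0..2 * pi} x \<partial>lborel) / ennreal (2 * pi)"
  proof -
    have 1: "(\<lambda>x. f (cis x)) \<in> borel_measurable lborel" by measurable
    have 2: "{0..2 * pi} \<in> sets lborel" by simp
    have 3: "emeasure lborel {0..2 * pi} = ennreal (2 * pi)"
      using emeasure_lborel_Icc[of 0 "2 * pi"] by (simp only: diff_zero) simp
    show ?thesis unfolding nn_integral_uniform_measure[OF 1 2] 3 ..
  qed
  also have "(\<integral>\<^sup>+x. f (cis x) * indicator {0..2 * pi} x \<partial>lborel) =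
      (\<integral>\<^sup>+x. f (cis x) * indicator {0..<2 * pi} x \<partial>lborel)"
    by (rule nn_integral_cong_AE, rule AE_mp[OF AE_lborel_singleton[of "2 * pi"]])
      (auto split: split_indicator)
  finally show ?thesis .
qed

lemma emeasure_haar_circle_UNIV: "emeasure haar_circle UNIV = 1"
proof -
  have "emeasure haar_circle UNIV = (\<integral>\<^sup>+\<zeta>. 1 \<partial>haar_circle)" by simp
  also have "\<dots> = ennreal (2 * pi) / ennreal (2 * pi)"
    by (subst nn_integral_haar_circle) simp_all
  also have "\<dots> = 1" by (intro ennreal_divide_self) simp_all
  finally show ?thesis .
qed

interpretation haar_circle: finite_measure haar_circle
  by standard (simp add: emeasure_haar_circle_UNIV)

lemma measure_haar_circle_UNIV [simp]: "measure haar_circle UNIV = 1"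
  by (simp add: measure_def emeasure_haar_circle_UNIV)

lemma AE_haar_circle_norm: "AE \<zeta> in haar_circle. cmod \<zeta> = 1"
  unfolding haar_circle_def by (subst AE_distr_iff) simp_all

text \<open>The part of the interval beyond \<open>2 * pi\<close> is translated back by one period
  and fills the gap \<open>{0..<a}\<close>.\<close>

lemma nn_integral_period:
  fixes g :: "real \<Rightarrow> ennreal"
  assumes [measurable]: "g \<in> borel_measurable borel" and per: "\<And>x. g (x + 2 * pi) = g x"
    and a: "0 \<le> a" "a \<le> 2 * pi"
  shows "(\<integral>\<^sup>+x. g x * indicator {a..<a + 2 * pi} x \<partial>lborel) = (\<integral>\<^sup>+x. g x * indicator {0..<2 * pi} x \<partial>lborel)"
proof -
  have per': "g (2 * pi + x) = g x" for x using per[of x] by (simp add: add.commute)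
  have "(\<integral>\<^sup>+x. g x * indicator {2 * pi..<2 * pi + a} x \<partial>lborel) =
      (\<integral>\<^sup>+x. g (2 * pi + 1 * x) * indicator {2 * pi..<2 * pi + a} (2 * pi + 1 * x) \<partial>lborel)"
    by (subst nn_integral_real_affine[where c = 1 and t = "2 * pi"]) simp_all
  also have "\<dots> = (\<integral>\<^sup>+x. g x * indicator {0..<a} x \<partial>lborel)"
    by (intro nn_integral_cong) (simp add: per' split: split_indicator)
  finally have shift: "(\<integral>\<^sup>+x. g x * indicator {2 * pi..<2 * pi + a} x \<partial>lborel) = (\<integral>\<^sup>+x. g x * indicator {0..<a} x \<partial>lborel)" .
  have "(\<integral>\<^sup>+x. g x * indicator {a..<a + 2 * pi} x \<partial>lborel) =
      (\<integral>\<^sup>+x. g x * indicator {a..<2 * pi} x + g x * indicator {2 * pi..<2 * pi + a} x \<partial>lborel)"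
    using a by (intro nn_integral_cong) (auto split: split_indicator)
  also have "\<dots> = (\<integral>\<^sup>+x. g x * indicator {a..<2 * pi} x \<partial>lborel) + (\<integral>\<^sup>+x. g x * indicator {0..<a} x \<partial>lborel)"
    by (subst nn_integral_add) (simp_all add: shift)
  also have "\<dots> = (\<integral>\<^sup>+x. g x * indicator {a..<2 * pi} x + g x * indicator {0..<a} x \<partial>lborel)"
    by (subst nn_integral_add) simp_all
  also have "\<dots> = (\<integral>\<^sup>+x. g x * indicator {0..<2 * pi} x \<partial>lborel)"
    using a by (intro nn_integral_cong) (auto split: split_indicator)
  finally show ?thesis .
qed

lemma cis_add_2pi: "cis (x + 2 * pi) = cis x"
  by (simp flip: cis_mult)

text \<open>Turns invariance of the measure into a change of variables in the angle; taking f to be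
  an indicator function identifies the two measures.\<close>

lemma distr_haar_circleI:
  assumes [measurable]: "h \<in> borel_measurable borel"
    and eq: "\<And>f. f \<in> borel_measurable borel \<Longrightarrow>
      (\<integral>\<^sup>+x. f (h (cis x)) * indicator {0..<2 * pi} x \<partial>lborel) = (\<integral>\<^sup>+x. f (cis x) * indicator {0..<2 * pi} x \<partial>lborel)"
  shows "distr haar_circle borel h = haar_circle"
proof (rule measure_eqI)
  fix A assume "A \<in> sets (distr haar_circle borel h)"
  then have [measurable]: "A \<in> sets borel" by simp
  have "emeasure (distr haar_circle borel h) A = (\<integral>\<^sup>+\<zeta>. indicator A (h \<zeta>) \<partial>haar_circle)"
    by (subst nn_integral_indicator[symmetric], simp, subst nn_integral_distr) simp_all
  also have "\<dots> = (\<integral>\<^sup>+\<zeta>. indicator A \<zeta> \<partial>haar_circle)"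
    by (simp add: nn_integral_haar_circle eq del: nn_integral_indicator)
  also have "\<dots> = emeasure haar_circle A" by simp
  finally show "emeasure (distr haar_circle borel h) A = emeasure haar_circle A" .
qed simp

lemma distr_haar_circle_rotate:
  assumes "0 \<le> t" "t \<le> 2 * pi"
  shows "distr haar_circle borel (\<lambda>\<zeta>. cis t * \<zeta>) = haar_circle"
proof (rule distr_haar_circleI)
  fix f :: "complex \<Rightarrow> ennreal" assume [measurable]: "f \<in> borel_measurable borel"
  have "(\<integral>\<^sup>+x. f (cis x) * indicator {t..<t + 2 * pi} x \<partial>lborel) =
      (\<integral>\<^sup>+x. f (cis (t + 1 * x)) * indicator {t..<t + 2 * pi} (t + 1 * x) \<partial>lborel)"
    by (subst nn_integral_real_affine[where c = 1 and t = t]) simp_all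
  also have "\<dots> = (\<integral>\<^sup>+x. f (cis t * cis x) * indicator {0..<2 * pi} x \<partial>lborel)"
    by (intro nn_integral_cong) (simp add: cis_mult split: split_indicator)
  finally show "(\<integral>\<^sup>+x. f (cis t * cis x) * indicator {0..<2 * pi} x \<partial>lborel) =
      (\<integral>\<^sup>+x. f (cis x) * indicator {0..<2 * pi} x \<partial>lborel)"
    using nn_integral_period[of "\<lambda>x. f (cis x)" t] assms by (simp add: cis_add_2pi)
qed simp

lemma distr_haar_circle_square: "distr haar_circle borel (\<lambda>\<zeta>. \<zeta>\<^sup>2) = haar_circle"
proof (rule distr_haar_circleI)
  fix f :: "complex \<Rightarrow> ennreal" assume [measurable]: "f \<in> borel_measurable borel"
  let ?J = "\<integral>\<^sup>+x. f (cis x) * indicator {0..<2 * pi} x \<partial>lborel"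
  let ?D = "\<integral>\<^sup>+x. f ((cis x)\<^sup>2) * indicator {0..<2 * pi} x \<partial>lborel"
  have cis2: "cis (2 * x) = (cis x)\<^sup>2" for x by (simp add: Complex.DeMoivre)
  \<comment> \<open>Doubling the angle winds one period twice around the circle: two adjacent
    periods form \<open>{0..<4 * pi}\<close>, and substituting \<open>2 * x\<close> returns to one
    period with Jacobian 2, which cancels at the end.\<close>
  have "?J + ?J = (\<integral>\<^sup>+x. f (cis x) * indicator {0..<2 * pi} x \<partial>lborel) + (\<integral>\<^sup>+x. f (cis x) * indicator {2 * pi..<2 * pi + 2 * pi} x \<partial>lborel)"
    by (subst nn_integral_period[of "\<lambda>x. f (cis x)" "2 * pi"]) (simp_all add: cis_add_2pi)
  also have "\<dots> = (\<integral>\<^sup>+x. f (cis x) * indicator {0..<2 * pi} x + f (cis x) * indicator {2 * pi..<2 * pi + 2 * pi} x \<partial>lborel)"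
    by (subst nn_integral_add) simp_all
  also have "\<dots> = (\<integral>\<^sup>+x. f (cis x) * indicator {0..<4 * pi} x \<partial>lborel)"
    by (intro nn_integral_cong) (auto split: split_indicator)
  also have "\<dots> = ennreal \<bar>2\<bar> * (\<integral>\<^sup>+x. f (cis (0 + 2 * x)) * indicator {0..<4 * pi} (0 + 2 * x) \<partial>lborel)"
    by (rule nn_integral_real_affine) simp_all
  also have "(\<integral>\<^sup>+x. f (cis (0 + 2 * x)) * indicator {0..<4 * pi} (0 + 2 * x) \<partial>lborel) = ?D"
    by (intro nn_integral_cong) (simp add: cis2 split: split_indicator)
  finally have eq: "2 * ?D = 2 * ?J" by (simp only: mult_2[symmetric]) simp
  show "?D = ?J"
    using eq by (simp add: ennreal_mult_cancel_left)
qed simp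

lemma
  fixes f :: "complex \<Rightarrow> 'b::{banach, second_countable_topology}"
  assumes h: "distr haar_circle borel h = haar_circle" and [measurable]: "h \<in> borel_measurable borel"
    "f \<in> borel_measurable borel"
  shows integral_haar_circle_invariant: "(\<integral>\<zeta>. f (h \<zeta>) \<partial>haar_circle) = (\<integral>\<zeta>. f \<zeta> \<partial>haar_circle)"
    and integrable_haar_circle_invariant: "integrable haar_circle (\<lambda>\<zeta>. f (h \<zeta>)) \<longleftrightarrow> integrable haar_circle f"
  using integral_distr[of h haar_circle borel f] integrable_distr_eq[of h haar_circle borel f]
  by (simp_all add: h)

text \<open>\<open>cis\<close> is injective on \<open>{0..<2 * pi}\<close>, so the preimage
  \<open>S\<close> of a point has at most one element.\<close>

lemma AE_haar_circle_neq: "AE \<zeta> in haar_circle. \<zeta> \<noteq> c"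
proof -
  define S where "S = {x \<in> {0..<2 * pi}. cis x = c}"
  have "x = y" if "x \<in> S" "y \<in> S" for x y
  proof -
    have "cis x = cis y" "x \<in> {0..<2 * pi}" "y \<in> {0..<2 * pi}" using that by (auto simp: S_def)
    then show ?thesis using Arg2pi_unique[of 1 x "cis x"] Arg2pi_unique[of 1 y "cis y"]
      by (simp add: cis_conv_exp)
  qed
  then have "S = {} \<or> (\<exists>x. S = {x})" by blast
  then have "countable S" by auto
  then have "emeasure lborel S = 0" by (rule emeasure_lborel_countable)
  then have AE: "AE x in lborel. x \<notin> S"
    using \<open>countable S\<close> by (intro AE_not_in countable_imp_null_set_lborel)
  have "emeasure haar_circle {c} = (\<integral>\<^sup>+\<zeta>. indicator {c} \<zeta> \<partial>haar_circle)" by simp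
  also have "\<dots> = (\<integral>\<^sup>+x. indicator {c} (cis x) * indicator {0..<2 * pi} x \<partial>lborel) / ennreal (2 * pi)"
    by (rule nn_integral_haar_circle) simp
  also have "(\<integral>\<^sup>+x. indicator {c} (cis x) * indicator {0..<2 * pi} x \<partial>lborel) = (\<integral>\<^sup>+x. 0 \<partial>(lborel :: real measure))"
    by (rule nn_integral_cong_AE, rule AE_mp[OF AE]) (auto simp: S_def split: split_indicator)
  finally have "emeasure haar_circle {c} = 0" by simp
  then have "AE \<zeta> in haar_circle. \<zeta> \<notin> {c}" by (intro AE_not_in) auto
  then show ?thesis by simp
qed


section \<open>The mean of log |\<zeta> - a| over the circle\<close>

text \<open>Invariance under squaring replaces \<zeta> by its square on the left. The difference of
  squares then factors, and the factors \<zeta> - a and \<zeta> + a have the same mean because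
  negation preserves the measure.\<close>

lemma integral_ln_dist_square:
  assumes int: "integrable haar_circle (\<lambda>\<zeta>. ln (cmod (\<zeta> - a)))"
  shows "(\<integral>\<zeta>. ln (cmod (\<zeta> - a\<^sup>2)) \<partial>haar_circle) = 2 * (\<integral>\<zeta>. ln (cmod (\<zeta> - a)) \<partial>haar_circle)"
proof -
  have neg: "distr haar_circle borel (\<lambda>\<zeta>. - \<zeta>) = haar_circle"
    using distr_haar_circle_rotate[of pi] by simp
  have *: "cmod (- \<zeta> - a) = cmod (\<zeta> + a)" for \<zeta>
    using norm_minus_cancel[of "\<zeta> + a"] by simp
  have int': "integrable haar_circle (\<lambda>\<zeta>. ln (cmod (\<zeta> + a)))"
    and eq: "(\<integral>\<zeta>. ln (cmod (\<zeta> + a)) \<partial>haar_circle) = (\<integral>\<zeta>. ln (cmod (\<zeta> - a)) \<partial>haar_circle)"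
    using integral_haar_circle_invariant[OF neg, of "\<lambda>\<zeta>. ln (cmod (\<zeta> - a))"]
      integrable_haar_circle_invariant[OF neg, of "\<lambda>\<zeta>. ln (cmod (\<zeta> - a))"] int
    by (simp_all add: *)
  have "(\<integral>\<zeta>. ln (cmod (\<zeta> - a\<^sup>2)) \<partial>haar_circle) = (\<integral>\<zeta>. ln (cmod (\<zeta>\<^sup>2 - a\<^sup>2)) \<partial>haar_circle)"
    using integral_haar_circle_invariant[OF distr_haar_circle_square, of "\<lambda>\<zeta>. ln (cmod (\<zeta> - a\<^sup>2))"] by simp
  also have "\<dots> = (\<integral>\<zeta>. ln (cmod (\<zeta> - a)) + ln (cmod (\<zeta> + a)) \<partial>haar_circle)"
  proof (rule integral_cong_AE)
    \<comment> \<open>The logarithm is additive only away from the zeros, in view of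
      \<open>ln 0 = 0\<close>; the points a and -a form a null set.\<close>
    show "AE \<zeta> in haar_circle. ln (cmod (\<zeta>\<^sup>2 - a\<^sup>2)) = ln (cmod (\<zeta> - a)) + ln (cmod (\<zeta> + a))"
      using AE_haar_circle_neq[of a] AE_haar_circle_neq[of "- a"]
    proof eventually_elim
      case (elim \<zeta>)
      then have "\<zeta> - a \<noteq> 0" "\<zeta> + a \<noteq> 0" by (auto simp: add_eq_0_iff)
      moreover have "\<zeta>\<^sup>2 - a\<^sup>2 = (\<zeta> - a) * (\<zeta> + a)" by (simp add: power2_eq_square algebra_simps)
      ultimately show ?case by (simp add: norm_mult ln_mult)
    qed
  qed simp_all
  also have "\<dots> = 2 * (\<integral>\<zeta>. ln (cmod (\<zeta> - a)) \<partial>haar_circle)"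
    using int int' by (simp add: eq)
  finally show ?thesis .
qed

text \<open>Each squaring of a doubles the mean, so a non-zero mean would outgrow every bound
  B.\<close>

lemma integral_ln_dist_eq_0_if_bounded:
  assumes int: "\<And>n. integrable haar_circle (\<lambda>\<zeta>. ln (cmod (\<zeta> - a ^ 2 ^ n)))"
    and bound: "\<And>n. \<bar>\<integral>\<zeta>. ln (cmod (\<zeta> - a ^ 2 ^ n)) \<partial>haar_circle\<bar> \<le> B"
  shows "(\<integral>\<zeta>. ln (cmod (\<zeta> - a)) \<partial>haar_circle) = 0"
proof (rule ccontr)
  let ?I = "\<integral>\<zeta>. ln (cmod (\<zeta> - a)) \<partial>haar_circle"
  assume "?I \<noteq> 0"
  have "(\<integral>\<zeta>. ln (cmod (\<zeta> - a ^ 2 ^ n)) \<partial>haar_circle) = 2 ^ n * ?I" for n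
  proof (induction n)
    case (Suc n)
    have "a ^ 2 ^ Suc n = (a ^ 2 ^ n)\<^sup>2" by (simp add: mult.commute flip: power_mult)
    then show ?case using integral_ln_dist_square[OF int[of n]] Suc by simp
  qed simp
  then have le: "2 ^ n * \<bar>?I\<bar> \<le> B" for n using bound[of n] by (simp add: abs_mult)
  obtain n where "B / \<bar>?I\<bar> < 2 ^ n" using real_arch_pow[of 2 "B / \<bar>?I\<bar>"] by auto
  then show False using le[of n] \<open>?I \<noteq> 0\<close> by (simp add: field_simps)
qed

text \<open>For |b| \<le> |a| the distance from b to the circle point lies between 1 - |a| and 2,
  which bounds the logarithm uniformly; all powers of a with positive exponent stay in this smaller
  disc.\<close>

lemma
  assumes a: "cmod a < 1"
  shows integrable_ln_dist_inside: "integrable haar_circle (\<lambda>\<zeta>. ln (cmod (\<zeta> - a)))"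
    and integral_ln_dist_inside: "(\<integral>\<zeta>. ln (cmod (\<zeta> - a)) \<partial>haar_circle) = 0"
proof -
  have AE: "AE \<zeta> in haar_circle. norm (ln (cmod (\<zeta> - b))) \<le> ln 2 - ln (1 - cmod a)"
    if b: "cmod b \<le> cmod a" for b
    using AE_haar_circle_norm
  proof eventually_elim
    case (elim \<zeta>)
    have 1: "1 - cmod a \<le> cmod (\<zeta> - b)" using norm_triangle_ineq2[of \<zeta> b] elim b by simp
    moreover have "cmod (\<zeta> - b) \<le> 2" using norm_triangle_ineq4[of \<zeta> b] elim a b by simp
    ultimately have "ln (1 - cmod a) \<le> ln (cmod (\<zeta> - b))" "ln (cmod (\<zeta> - b)) \<le> ln 2"
      using a by (auto intro!: ln_mono intro: order.strict_trans2[of 0 "1 - cmod a"])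
    moreover have "ln (1 - cmod a) \<le> 0" using a by simp
    moreover have "(0::real) \<le> ln 2" by simp
    ultimately show ?case unfolding real_norm_def abs_le_iff by linarith
  qed
  have int: "integrable haar_circle (\<lambda>\<zeta>. ln (cmod (\<zeta> - b)))"
    and bound: "\<bar>\<integral>\<zeta>. ln (cmod (\<zeta> - b)) \<partial>haar_circle\<bar> \<le> ln 2 - ln (1 - cmod a)"
    if b: "cmod b \<le> cmod a" for b
  proof -
    show int: "integrable haar_circle (\<lambda>\<zeta>. ln (cmod (\<zeta> - b)))"
      by (rule haar_circle.integrable_const_bound[OF AE[OF b]]) simp
    have "norm (\<integral>\<zeta>. ln (cmod (\<zeta> - b)) \<partial>haar_circle) \<le> (\<integral>\<zeta>. norm (ln (cmod (\<zeta> - b))) \<partial>haar_circle)"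
      by (rule integral_norm_bound)
    also have "\<dots> \<le> (\<integral>\<zeta>. ln 2 - ln (1 - cmod a) \<partial>haar_circle)"
      using int AE[OF b] by (intro integral_mono_AE) simp_all
    finally show "\<bar>\<integral>\<zeta>. ln (cmod (\<zeta> - b)) \<partial>haar_circle\<bar> \<le> ln 2 - ln (1 - cmod a)" by simp
  qed
  have pow: "cmod (a ^ 2 ^ n) \<le> cmod a" for n
    using a power_decreasing[of 1 "2 ^ n" "cmod a"] by (simp add: norm_power)
  show "integrable haar_circle (\<lambda>\<zeta>. ln (cmod (\<zeta> - a)))" by (rule int) simp
  show "(\<integral>\<zeta>. ln (cmod (\<zeta> - a)) \<partial>haar_circle) = 0"
    by (rule integral_ln_dist_eq_0_if_bounded[OF int[OF pow] bound[OF pow]])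
qed

text \<open>On the circle, integrability and the bounds that make the doubling argument work come from
  Fatou's lemma along \<open>r a\<close> with \<open>r\<close> tending to 1.\<close>

lemma
  assumes a: "cmod a = 1"
  shows integrable_ln_dist_circle: "integrable haar_circle (\<lambda>\<zeta>. ln (cmod (\<zeta> - a)))"
    and integral_ln_dist_circle: "(\<integral>\<zeta>. ln (cmod (\<zeta> - a)) \<partial>haar_circle) = 0"
proof -
  have le2: "ln (cmod (\<zeta> - b)) \<le> ln 2" if "cmod \<zeta> = 1" "cmod b \<le> 1" for \<zeta> b
  proof (cases "\<zeta> = b")
    case False
    have "cmod (\<zeta> - b) \<le> 2" using norm_triangle_ineq4[of \<zeta> b] that by simp
    then show ?thesis using False by (simp add: ln_mono)
  qed simp
  have main: "integrable haar_circle (\<lambda>\<zeta>. ln (cmod (\<zeta> - b))) \<and>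
      \<bar>\<integral>\<zeta>. ln (cmod (\<zeta> - b)) \<partial>haar_circle\<bar> \<le> ln 2" if b: "cmod b = 1" for b
  proof -
    define r where "r n = 1 - inverse (real (Suc n))" for n
    have r: "cmod (r n * b) < 1" for n
    proof -
      have "0 \<le> r n" "r n < 1" by (simp_all add: r_def inverse_le_1_iff)
      then show ?thesis by (simp add: norm_mult b)
    qed
    have "r \<longlonglongrightarrow> 1 - 0" unfolding r_def by (intro tendsto_intros LIMSEQ_inverse_real_of_nat)
    then have rlim: "(\<lambda>n. complex_of_real (r n) * b) \<longlonglongrightarrow> b"
      by (auto intro!: tendsto_eq_intros)
    \<comment> \<open>Subtracting from \<open>ln 2\<close> makes the integrand nonnegative, as
      Fatou's lemma requires. Its mean is exactly \<open>ln 2\<close>, since at points inside the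
      disc the logarithm has mean 0.\<close>
    have intu: "(\<integral>\<^sup>+\<zeta>. ennreal (ln 2 - ln (cmod (\<zeta> - r n * b))) \<partial>haar_circle) = ennreal (ln 2)" for n
    proof (subst nn_integral_eq_integral)
      show "integrable haar_circle (\<lambda>\<zeta>. ln 2 - ln (cmod (\<zeta> - r n * b)))"
        using integrable_ln_dist_inside[OF r] by simp
      show "AE \<zeta> in haar_circle. 0 \<le> ln 2 - ln (cmod (\<zeta> - r n * b))"
        using AE_haar_circle_norm by eventually_elim (use le2 r less_imp_le in \<open>simp add: less_imp_le\<close>)
      show "ennreal (\<integral>\<zeta>. ln 2 - ln (cmod (\<zeta> - r n * b)) \<partial>haar_circle) = ennreal (ln 2)"
        using integrable_ln_dist_inside[OF r] integral_ln_dist_inside[OF r] by simp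
    qed
    have "(\<integral>\<^sup>+\<zeta>. ennreal (ln 2 - ln (cmod (\<zeta> - b))) \<partial>haar_circle) =
        (\<integral>\<^sup>+\<zeta>. liminf (\<lambda>n. ennreal (ln 2 - ln (cmod (\<zeta> - r n * b)))) \<partial>haar_circle)"
    proof (rule nn_integral_cong_AE)
      show "AE \<zeta> in haar_circle. ennreal (ln 2 - ln (cmod (\<zeta> - b))) = liminf (\<lambda>n. ennreal (ln 2 - ln (cmod (\<zeta> - r n * b))))"
        using AE_haar_circle_neq[of b]
      proof eventually_elim
        case (elim \<zeta>)
        then have "(\<lambda>n. ennreal (ln 2 - ln (cmod (\<zeta> - r n * b)))) \<longlonglongrightarrow> ennreal (ln 2 - ln (cmod (\<zeta> - b)))"
          by (intro tendsto_ennrealI tendsto_intros rlim) simp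
        then show ?case by (intro lim_imp_Liminf[symmetric]) simp_all
      qed
    qed
    also have "\<dots> \<le> liminf (\<lambda>n. \<integral>\<^sup>+\<zeta>. ennreal (ln 2 - ln (cmod (\<zeta> - r n * b))) \<partial>haar_circle)"
      by (rule nn_integral_liminf) simp
    finally have fatou: "(\<integral>\<^sup>+\<zeta>. ennreal (ln 2 - ln (cmod (\<zeta> - b))) \<partial>haar_circle) \<le> ennreal (ln 2)"
      by (simp add: intu Liminf_const)
    have nonneg: "AE \<zeta> in haar_circle. 0 \<le> ln 2 - ln (cmod (\<zeta> - b))"
      using AE_haar_circle_norm by eventually_elim (use le2 b in simp)
    have int: "integrable haar_circle (\<lambda>\<zeta>. ln 2 - ln (cmod (\<zeta> - b)))"
      using fatou by (intro integrableI_nonneg nonneg) (auto intro: le_less_trans)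
    \<comment> \<open>The mean of this difference lies in [0, ln 2], hence so does the mean of the
      logarithm itself: a bound independent of b.\<close>
    have "(\<integral>\<zeta>. ln 2 - ln (cmod (\<zeta> - b)) \<partial>haar_circle) \<le> ln 2"
      using fatou nn_integral_eq_integral[OF int nonneg] by (simp del: integral_diff)
    moreover have "0 \<le> (\<integral>\<zeta>. ln 2 - ln (cmod (\<zeta> - b)) \<partial>haar_circle)"
      by (rule integral_nonneg_AE[OF nonneg])
    moreover have cancel: "ln 2 - (ln 2 - y) = y" for y :: real by simp
    have "integrable haar_circle (\<lambda>\<zeta>. ln 2 - (ln 2 - ln (cmod (\<zeta> - b))))"
      by (rule Bochner_Integration.integrable_diff[OF _ int]) simp
    then have int': "integrable haar_circle (\<lambda>\<zeta>. ln (cmod (\<zeta> - b)))" unfolding cancel .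
    moreover note int'
    moreover have "(\<integral>\<zeta>. ln 2 - ln (cmod (\<zeta> - b)) \<partial>haar_circle) = ln 2 - (\<integral>\<zeta>. ln (cmod (\<zeta> - b)) \<partial>haar_circle)"
      using int' by simp
    ultimately show ?thesis unfolding abs_le_iff by linarith
  qed
  have pow: "cmod (a ^ 2 ^ n) = 1" for n by (simp add: norm_power a)
  show "integrable haar_circle (\<lambda>\<zeta>. ln (cmod (\<zeta> - a)))" using main[OF a] by blast
  show "(\<integral>\<zeta>. ln (cmod (\<zeta> - a)) \<partial>haar_circle) = 0"
    by (rule integral_ln_dist_eq_0_if_bounded[where B = "ln 2"]) (use main[OF pow] in blast)+
qed

text \<open>Reflection in the unit circle: on it, 1 may be written as \<zeta> times its conjugate.
  This brings a point outside the closed disc to one inside.\<close>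

lemma norm_diff_reflect:
  assumes "cmod \<zeta> = 1" "a \<noteq> 0"
  shows "cmod (\<zeta> - a) = cmod a * cmod (\<zeta> - inverse (cnj a))"
proof -
  have "\<zeta> * cnj \<zeta> = 1" using assms by (simp add: complex_norm_square[symmetric])
  have "cmod a * cmod (\<zeta> - inverse (cnj a)) = cmod (cnj a * (\<zeta> - inverse (cnj a)))"
    by (simp add: norm_mult)
  also have "cnj a * (\<zeta> - inverse (cnj a)) = \<zeta> * cnj (a - \<zeta>)"
    using assms \<open>\<zeta> * cnj \<zeta> = 1\<close> by (simp add: algebra_simps)
  also have "cmod \<dots> = cmod (\<zeta> - a)"
    using assms by (simp add: norm_mult norm_minus_commute del: complex_cnj_diff)
  finally show ?thesis ..
qed

text \<open>Jensen's formula for a single linear factor. For |a| > 1 the reflection splits off the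
  constant ln |a| and leaves a point inside the disc, whose contribution is 0.\<close>

lemma
  shows integrable_ln_dist: "integrable haar_circle (\<lambda>\<zeta>. ln (cmod (\<zeta> - a)))"
    and integral_ln_dist: "(\<integral>\<zeta>. ln (cmod (\<zeta> - a)) \<partial>haar_circle) = ln (max 1 (cmod a))"
proof -
  have "integrable haar_circle (\<lambda>\<zeta>. ln (cmod (\<zeta> - a))) \<and>
      (\<integral>\<zeta>. ln (cmod (\<zeta> - a)) \<partial>haar_circle) = ln (max 1 (cmod a))"
  proof (cases "cmod a \<le> 1")
    case True
    then show ?thesis
      using integrable_ln_dist_inside integral_ln_dist_inside integrable_ln_dist_circle integral_ln_dist_circle
      by (cases "cmod a = 1") (simp_all add: max_def)
  next
    case False
    then have a: "a \<noteq> 0" "cmod (inverse (cnj a)) < 1"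
      by (auto simp: norm_inverse intro: inverse_less_1_iff[THEN iffD2])
    have AE: "AE \<zeta> in haar_circle. ln (cmod (\<zeta> - a)) = ln (cmod a) + ln (cmod (\<zeta> - inverse (cnj a)))"
      using AE_haar_circle_norm AE_haar_circle_neq[of "inverse (cnj a)"]
      by eventually_elim (simp add: norm_diff_reflect[OF _ a(1)] ln_mult a(1))
    have "integrable haar_circle (\<lambda>\<zeta>. ln (cmod (\<zeta> - a))) \<longleftrightarrow>
        integrable haar_circle (\<lambda>\<zeta>. ln (cmod a) + ln (cmod (\<zeta> - inverse (cnj a))))"
      by (rule integrable_cong_AE[OF _ _ AE]) simp_all
    moreover have "(\<integral>\<zeta>. ln (cmod (\<zeta> - a)) \<partial>haar_circle) =
        (\<integral>\<zeta>. ln (cmod a) + ln (cmod (\<zeta> - inverse (cnj a))) \<partial>haar_circle)"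
      by (rule integral_cong_AE[OF _ _ AE]) simp_all
    ultimately show ?thesis
      using integrable_ln_dist_inside[OF a(2)] integral_ln_dist_inside[OF a(2)] False by (simp add: max_def)
  qed
  then show "integrable haar_circle (\<lambda>\<zeta>. ln (cmod (\<zeta> - a)))"
    "(\<integral>\<zeta>. ln (cmod (\<zeta> - a)) \<partial>haar_circle) = ln (max 1 (cmod a))" by blast+
qed

section \<open>Mahler measure of polynomials\<close>

text \<open>The fundamental theorem of algebra supplies a root as long as the degree is positive.
  Statements about the Mahler measure thus reduce to constants and to the effect of one more
  root.\<close>

lemma complex_poly_linear_factor_induct [consumes 1, case_names const linear]:
  fixes q :: "complex poly"
  assumes "q \<noteq> 0" and const: "\<And>c. c \<noteq> 0 \<Longrightarrow> P [:c:]"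
    and linear: "\<And>a q. q \<noteq> 0 \<Longrightarrow> P q \<Longrightarrow> P ([:- a, 1:] * q)"
  shows "P q"
  using \<open>q \<noteq> 0\<close>
proof (induction "degree q" arbitrary: q)
  case 0
  then show ?case using const by (metis degree_eq_zeroE pCons_eq_0_iff)
next
  case (Suc n)
  have "\<not> constant (poly q)" using Suc.hyps(2) by (simp add: constant_degree)
  then obtain a where "poly q a = 0" using fundamental_theorem_of_algebra by blast
  then obtain r where r: "q = [:- a, 1:] * r" by (auto simp: poly_eq_0_iff_dvd elim: dvdE)
  then have "r \<noteq> 0" using Suc.prems by auto
  moreover from this have "degree q = Suc (degree r)"
    unfolding r by (subst degree_mult_eq) auto
  ultimately show ?case using Suc.hyps linear r by simp
qed

lemma borel_measurable_poly [measurable]: "poly (q :: complex poly) \<in> borel_measurable borel"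
  by (intro borel_measurable_continuous_onI continuous_intros)

lemma AE_haar_circle_poly_neq_0:
  fixes q :: "complex poly"
  assumes "q \<noteq> 0"
  shows "AE \<zeta> in haar_circle. poly q \<zeta> \<noteq> 0"
  using assms
proof (induction q rule: complex_poly_linear_factor_induct)
  case (linear a q)
  show ?case using AE_haar_circle_neq[of a] linear(2) by eventually_elim auto
qed simp

lemma AE_ln_poly_mult:
  fixes q r :: "complex poly"
  assumes "q \<noteq> 0" "r \<noteq> 0"
  shows "AE \<zeta> in haar_circle. ln (cmod (poly (q * r) \<zeta>)) = ln (cmod (poly q \<zeta>)) + ln (cmod (poly r \<zeta>))"
  using AE_haar_circle_poly_neq_0[OF assms(1)] AE_haar_circle_poly_neq_0[OF assms(2)]
  by eventually_elim (simp add: norm_mult ln_mult)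

lemma integrable_ln_poly:
  fixes q :: "complex poly"
  assumes "q \<noteq> 0"
  shows "integrable haar_circle (\<lambda>\<zeta>. ln (cmod (poly q \<zeta>)))"
  using assms
proof (induction q rule: complex_poly_linear_factor_induct)
  case (linear a q)
  have "integrable haar_circle (\<lambda>\<zeta>. ln (cmod (poly ([:- a, 1:] * q) \<zeta>))) \<longleftrightarrow>
      integrable haar_circle (\<lambda>\<zeta>. ln (cmod (poly [:- a, 1:] \<zeta>)) + ln (cmod (poly q \<zeta>)))"
    by (rule integrable_cong_AE[OF _ _ AE_ln_poly_mult]) (use linear in simp_all)
  then show ?case using integrable_ln_dist[of a] linear(2) by simp
qed simp

lemma mahler_measure_mult:
  assumes "q \<noteq> 0" "r \<noteq> 0"
  shows "mahler_measure (q * r) = mahler_measure q * mahler_measure r"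
proof -
  have "(\<integral>\<zeta>. ln (cmod (poly (q * r) \<zeta>)) \<partial>haar_circle) =
      (\<integral>\<zeta>. ln (cmod (poly q \<zeta>)) + ln (cmod (poly r \<zeta>)) \<partial>haar_circle)"
    by (rule integral_cong_AE[OF _ _ AE_ln_poly_mult[OF assms]]) simp_all
  then show ?thesis
    using integrable_ln_poly assms by (simp add: mahler_measure_def exp_add)
qed

lemma mahler_measure_pos: "0 < mahler_measure q"
  by (simp add: mahler_measure_def)

lemma mahler_measure_const: "c \<noteq> 0 \<Longrightarrow> mahler_measure [:c:] = cmod c"
  by (simp add: mahler_measure_def)

lemma mahler_measure_linear: "mahler_measure [:- a, 1:] = max 1 (cmod a)"
  using integral_ln_dist[of a] by (simp add: mahler_measure_def)

text \<open>A further factor \<open>[:- a, 1:]\<close> keeps the leading coefficient and multiplies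
  the Mahler measure by \<open>max 1 (cmod a)\<close>. For monic polynomials the lower bound is
  1.\<close>

lemma lead_coeff_le_mahler_measure:
  assumes "q \<noteq> 0"
  shows "cmod (lead_coeff q) \<le> mahler_measure q"
  using assms
proof (induction q rule: complex_poly_linear_factor_induct)
  case (linear a q)
  have "lead_coeff ([:- a, 1:] * q) = lead_coeff q" by (subst lead_coeff_mult) simp
  also have "cmod \<dots> \<le> max 1 (cmod a) * mahler_measure q"
    using linear(2) mahler_measure_pos[of q] mult_mono[of 1 "max 1 (cmod a)" "cmod (lead_coeff q)" "mahler_measure q"]
    by simp
  also have "\<dots> = mahler_measure ([:- a, 1:] * q)"
    using linear(1) by (subst mahler_measure_mult) (simp_all add: mahler_measure_linear)
  finally show ?case .
qed (simp add: mahler_measure_const)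

text \<open>A further linear factor combines two neighbouring coefficients with weights of modulus
  at most \<open>max 1 (cmod a)\<close>, the factor gained by the Mahler measure; Pascal's rule adds
  up the binomials.\<close>

lemma coeff_le_mahler_measure:
  assumes "q \<noteq> 0"
  shows "cmod (coeff q i) \<le> real (degree q choose i) * mahler_measure q"
  using assms
proof (induction q arbitrary: i rule: complex_poly_linear_factor_induct)
  case (const c)
  then show ?case by (cases i) (simp_all add: mahler_measure_const)
next
  case (linear a q)
  let ?m = "max 1 (cmod a)"
  have M: "mahler_measure ([:- a, 1:] * q) = ?m * mahler_measure q"
    using linear(1) by (subst mahler_measure_mult) (simp_all add: mahler_measure_linear)
  have deg: "degree ([:- a, 1:] * q) = Suc (degree q)"
    using linear(1) by (subst degree_mult_eq) auto
  have le: "cmod a * cmod (coeff q j) \<le> ?m * (real (degree q choose j) * mahler_measure q)"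
    "cmod (coeff q j) \<le> ?m * (real (degree q choose j) * mahler_measure q)" for j
    using mult_mono[OF _ linear(2), of "cmod a" ?m j] mult_mono[OF _ linear(2), of 1 ?m j] by simp_all
  show ?case
  proof (cases i)
    case 0
    then show ?thesis using le(1)[of 0] unfolding M by (simp add: norm_mult)
  next
    case (Suc j)
    have "cmod (coeff ([:- a, 1:] * q) i) \<le> cmod a * cmod (coeff q (Suc j)) + cmod (coeff q j)"
      using norm_triangle_ineq[of "- a * coeff q (Suc j)" "coeff q j"] by (simp add: Suc norm_mult)
    also have "\<dots> \<le> real (Suc (degree q) choose Suc j) * (?m * mahler_measure q)"
      using add_mono[OF le(1)[of "Suc j"] le(2)[of j]] by (simp add: algebra_simps)
    finally show ?thesis by (simp only: M deg Suc)
  qed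
qed

section \<open>Parseval on the circle; comparing the norm with the Mahler measure\<close>

lemma borel_measurable_monomials: "(\<lambda>\<zeta>::complex. \<zeta> ^ i * cnj (\<zeta> ^ j)) \<in> borel_measurable borel"
  by (intro borel_measurable_continuous_onI continuous_intros)

lemma integral_haar_circle_monomials:
  "(\<integral>\<zeta>. \<zeta> ^ i * cnj (\<zeta> ^ j) \<partial>haar_circle) = (if i = j then 1 else 0)"
proof -
  let ?E = "\<lambda>i j. \<integral>\<zeta>. \<zeta> ^ i * cnj (\<zeta> ^ j) \<partial>haar_circle"
  have zero: "?E i j = 0" if "j < i" for i j
  proof -
    \<comment> \<open>The rotation by this angle multiplies the integrand by \<open>cis pi\<close>,
      that is by -1, so the integral equals its own negative.\<close>
    define t where "t = pi / real (i - j)"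
    have "pi / real (i - j) \<le> pi / 1" using that by (intro divide_left_mono) simp_all
    then have "t \<le> 2 * pi" unfolding t_def div_by_1 by (rule order_trans) simp
    moreover have "0 \<le> t" by (simp add: t_def)
    ultimately have t: "0 \<le> t" "t \<le> 2 * pi" by auto
    have "?E i j = (\<integral>\<zeta>. (cis t * \<zeta>) ^ i * cnj ((cis t * \<zeta>) ^ j) \<partial>haar_circle)"
      using integral_haar_circle_invariant[OF distr_haar_circle_rotate[OF t], of "\<lambda>\<zeta>. \<zeta> ^ i * cnj (\<zeta> ^ j)"]
        borel_measurable_monomials[of i j] by simp
    also have "\<dots> = (\<integral>\<zeta>. (cis t ^ i * cnj (cis t ^ j)) * (\<zeta> ^ i * cnj (\<zeta> ^ j)) \<partial>haar_circle)"
      by (simp add: power_mult_distrib mult_ac)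
    also have "cis t ^ i * cnj (cis t ^ j) = cis (real (i - j) * t)"
      using that by (simp add: Complex.DeMoivre cis_cnj cis_mult of_nat_diff algebra_simps del: complex_cnj_power)
    also have "real (i - j) * t = pi" using that by (simp add: t_def)
    finally have "?E i j = - ?E i j" by simp
    moreover have "x = 0" if "x = - x" for x :: complex using that by (simp add: complex_eq_iff)
    ultimately show ?thesis by blast
  qed
  have sym: "?E i j = cnj (?E j i)" for i j
    unfolding Bochner_Integration.integral_cnj[symmetric] by (simp add: mult.commute)
  have "?E i i = 1" for i
  proof -
    have "?E i i = (\<integral>\<zeta>. 1 \<partial>haar_circle)"
      by (rule integral_cong_AE, use borel_measurable_monomials[of i i] in simp, simp, rule AE_mp[OF AE_haar_circle_norm])
        (simp add: complex_norm_square[symmetric] flip: power_mult_distrib)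
    then show ?thesis by simp
  qed
  then show ?thesis using zero[of i j] zero[of j i] sym[of i j]
    by (cases i j rule: linorder_cases) simp_all
qed

lemma integrable_haar_circle_monomials: "integrable haar_circle (\<lambda>\<zeta>. \<zeta> ^ i * cnj (\<zeta> ^ j))"
proof (rule haar_circle.integrable_const_bound)
  show "AE \<zeta> in haar_circle. norm (\<zeta> ^ i * cnj (\<zeta> ^ j)) \<le> 1"
    using AE_haar_circle_norm by eventually_elim (simp add: norm_mult norm_power)
  show "(\<lambda>\<zeta>. \<zeta> ^ i * cnj (\<zeta> ^ j)) \<in> borel_measurable haar_circle"
    using borel_measurable_monomials[of i j] by simp
qed

lemma
  shows integrable_norm_poly_square: "integrable haar_circle (\<lambda>\<zeta>. (cmod (poly q \<zeta>))\<^sup>2)"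
    and integral_norm_poly_square:
      "(\<integral>\<zeta>. (cmod (poly q \<zeta>))\<^sup>2 \<partial>haar_circle) = (\<Sum>i\<le>degree q. (cmod (coeff q i))\<^sup>2)"
proof -
  let ?f = "\<lambda>\<zeta>. \<Sum>i\<le>degree q. \<Sum>j\<le>degree q. (coeff q i * cnj (coeff q j)) * (\<zeta> ^ i * cnj (\<zeta> ^ j))"
  have f: "complex_of_real ((cmod (poly q \<zeta>))\<^sup>2) = ?f \<zeta>" for \<zeta>
    unfolding complex_norm_square poly_altdef cnj_sum sum_product by (simp add: mult_ac)
  have int: "integrable haar_circle (\<lambda>\<zeta>. (coeff q i * cnj (coeff q j)) * (\<zeta> ^ i * cnj (\<zeta> ^ j)))" for i j
    using integrable_haar_circle_monomials[of i j] by (intro integrable_mult_right)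
  have "integrable haar_circle (\<lambda>\<zeta>. complex_of_real ((cmod (poly q \<zeta>))\<^sup>2))"
    unfolding f by (intro Bochner_Integration.integrable_sum int)
  then show "integrable haar_circle (\<lambda>\<zeta>. (cmod (poly q \<zeta>))\<^sup>2)"
    using complex_of_real_integrable_eq by blast
  have "complex_of_real (\<integral>\<zeta>. (cmod (poly q \<zeta>))\<^sup>2 \<partial>haar_circle) = (\<integral>\<zeta>. ?f \<zeta> \<partial>haar_circle)"
    unfolding integral_complex_of_real[symmetric] f ..
  also have "\<dots> = (\<Sum>i\<le>degree q. \<Sum>j\<le>degree q. \<integral>\<zeta>. (coeff q i * cnj (coeff q j)) * (\<zeta> ^ i * cnj (\<zeta> ^ j)) \<partial>haar_circle)"
    by (simp only: Bochner_Integration.integral_sum Bochner_Integration.integrable_sum int)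
  also have "\<dots> = (\<Sum>i\<le>degree q. \<Sum>j\<le>degree q. if i = j then coeff q i * cnj (coeff q j) else 0)"
    by (intro sum.cong refl) (simp add: integral_haar_circle_monomials del: complex_cnj_power)
  also have "\<dots> = complex_of_real (\<Sum>i\<le>degree q. (cmod (coeff q i))\<^sup>2)"
    by (simp add: complex_norm_square del: of_real_power)
  finally show "(\<integral>\<zeta>. (cmod (poly q \<zeta>))\<^sup>2 \<partial>haar_circle) = (\<Sum>i\<le>degree q. (cmod (coeff q i))\<^sup>2)"
    by (simp only: of_real_eq_iff)
qed

lemma circle_norm2_square: "(circle_norm2 q)\<^sup>2 = (\<Sum>i\<le>degree q. (cmod (coeff q i))\<^sup>2)"
  by (simp add: circle_norm2_def integral_norm_poly_square sum_nonneg)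

lemma circle_norm2_square_pos: "q \<noteq> 0 \<Longrightarrow> 0 < (circle_norm2 q)\<^sup>2"
  unfolding circle_norm2_square by (rule sum_pos2[of _ "degree q"]) auto

text \<open>Jensen's inequality, obtained by integrating ln x \<le> x - 1 at x = |q|^2 / c, where c
  is the squared norm: x has mean 1, so the right side has mean 0.\<close>

lemma mahler_measure_le_circle_norm2:
  assumes q: "q \<noteq> 0"
  shows "(mahler_measure q)\<^sup>2 \<le> (circle_norm2 q)\<^sup>2"
proof -
  define c where "c = (circle_norm2 q)\<^sup>2"
  have c: "0 < c" unfolding c_def by (rule circle_norm2_square_pos[OF q])
  have cint: "c = (\<integral>\<zeta>. (cmod (poly q \<zeta>))\<^sup>2 \<partial>haar_circle)"
    by (simp add: c_def circle_norm2_square integral_norm_poly_square)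
  have "(\<integral>\<zeta>. 2 * ln (cmod (poly q \<zeta>)) \<partial>haar_circle) \<le> (\<integral>\<zeta>. (ln c - 1) + (cmod (poly q \<zeta>))\<^sup>2 / c \<partial>haar_circle)"
  proof (rule integral_mono_AE)
    show "AE \<zeta> in haar_circle. 2 * ln (cmod (poly q \<zeta>)) \<le> (ln c - 1) + (cmod (poly q \<zeta>))\<^sup>2 / c"
      using AE_haar_circle_poly_neq_0[OF q]
    proof eventually_elim
      case (elim \<zeta>)
      have "ln ((cmod (poly q \<zeta>))\<^sup>2 / c) \<le> (cmod (poly q \<zeta>))\<^sup>2 / c - 1"
        using elim c by (intro ln_le_minus_one) simp
      moreover have "ln ((cmod (poly q \<zeta>))\<^sup>2 / c) = 2 * ln (cmod (poly q \<zeta>)) - ln c"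
        using elim c by (simp add: ln_div ln_realpow)
      ultimately show ?case by simp
    qed
  qed (use integrable_ln_poly[OF q] integrable_norm_poly_square in simp_all)
  also have "\<dots> = ln c"
    using integrable_norm_poly_square[of q] c by (simp flip: cint)
  finally have "2 * (\<integral>\<zeta>. ln (cmod (poly q \<zeta>)) \<partial>haar_circle) \<le> ln c" by simp
  then have "exp (2 * (\<integral>\<zeta>. ln (cmod (poly q \<zeta>)) \<partial>haar_circle)) \<le> c"
    using c by (subst ln_ge_iff[symmetric]) auto
  then show ?thesis by (simp add: mahler_measure_def c_def exp_double)
qed

text \<open>Parseval together with the coefficient bound; the squares of the binomials in one row
  add up to the central binomial coefficient.\<close>

lemma circle_norm2_le_mahler_measure:
  assumes "q \<noteq> 0"
  shows "(circle_norm2 q)\<^sup>2 \<le> real (2 * degree q choose degree q) * (mahler_measure q)\<^sup>2"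
proof -
  have "(circle_norm2 q)\<^sup>2 \<le> (\<Sum>i\<le>degree q. (real (degree q choose i) * mahler_measure q)\<^sup>2)"
    unfolding circle_norm2_square by (intro sum_mono power_mono coeff_le_mahler_measure assms) simp
  also have "\<dots> = real (\<Sum>i\<le>degree q. (degree q choose i)\<^sup>2) * (mahler_measure q)\<^sup>2"
    by (simp add: power_mult_distrib sum_distrib_right)
  finally show ?thesis unfolding choose_square_sum .
qed

text \<open>Row 2d of Pascal's triangle sums to \<open>4 ^ d\<close> and contains, besides the
  central entry, the entry 1 at index 0, a different place as d > 0.\<close>

lemma central_binomial_less:
  assumes "0 < d"
  shows "(2 * d) choose d < 4 ^ d"
proof -
  have "((2 * d) choose d) + 1 = (\<Sum>k\<in>{0, d}. (2 * d) choose k)" using assms by simp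
  also have "\<dots> \<le> (\<Sum>k\<le>2 * d. (2 * d) choose k)" by (intro sum_mono2) auto
  also have "\<dots> = 4 ^ d" by (simp add: choose_row_sum power_mult)
  finally show ?thesis by simp
qed

section \<open>Hilbert space geometry of the Hardy space\<close>

text \<open>The witness is the point of S nearest to g. Midpoints of a minimizing sequence stay in
  S, at distance at least d from g, so the parallelogram law makes the sequence Cauchy. With S the
  image of \<open>mult_z\<close> this will produce adjoints.\<close>

lemma complete_subspace_projection:
  fixes S :: "'a::real_inner set"
  assumes S: "subspace S" "complete S"
  shows "\<exists>s\<in>S. \<forall>f\<in>S. inner f (g - s) = 0"
proof -
  define d where "d = Inf ((\<lambda>s. norm (g - s)) ` S)"
  have bdd: "bdd_below ((\<lambda>s. norm (g - s)) ` S)" by (rule bdd_belowI[of _ 0]) auto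
  have ne: "S \<noteq> {}" using subspace_0[OF S(1)] by auto
  have d_le: "d \<le> norm (g - s)" if "s \<in> S" for s
    unfolding d_def using that bdd by (intro cInf_lower) auto
  have d0: "0 \<le> d" unfolding d_def using ne by (intro cInf_greatest) auto
  have "\<exists>s\<in>S. norm (g - s) < d + inverse (real (Suc n))" for n
    using cInf_lessD[of "(\<lambda>s. norm (g - s)) ` S" "d + inverse (real (Suc n))"] ne by (auto simp: d_def)
  then obtain x where xS: "\<And>n. x n \<in> S" and x: "\<And>n. norm (g - x n) < d + inverse (real (Suc n))"
    by metis
  have mid: "(norm (x m - x n))\<^sup>2 \<le> 2 * (norm (g - x m))\<^sup>2 + 2 * (norm (g - x n))\<^sup>2 - 4 * d\<^sup>2" for m n
  proof -
    let ?u = "g - x m" and ?v = "g - x n"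
    have "(1/2) *\<^sub>R (x m + x n) \<in> S" using S(1) xS by (intro subspace_scale subspace_add)
    then have "d \<le> norm (g - (1/2) *\<^sub>R (x m + x n))" by (rule d_le)
    also have "g - (1/2) *\<^sub>R (x m + x n) = (1/2) *\<^sub>R (?u + ?v)"
      by (simp add: algebra_simps flip: scaleR_add_left)
    finally have "2 * d \<le> norm (?u + ?v)" by simp
    then have "(2 * d)\<^sup>2 \<le> (norm (?u + ?v))\<^sup>2" using d0 by (intro power_mono) simp_all
    moreover have "(norm (?u + ?v))\<^sup>2 + (norm (?u - ?v))\<^sup>2 = 2 * (norm ?u)\<^sup>2 + 2 * (norm ?v)\<^sup>2"
      unfolding power2_norm_eq_inner by (simp only: inner_add_left inner_add_right inner_diff_left inner_diff_right) simp
    moreover have "?u - ?v = - (x m - x n)" by simp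
    ultimately show ?thesis by (simp only: norm_minus_cancel) (simp add: power_mult_distrib)
  qed
  have "Cauchy x"
  proof (rule metric_CauchyI)
    fix e :: real assume e: "0 < e"
    have "(\<lambda>n. 4 * (d + inverse (real (Suc n)))\<^sup>2 - 4 * d\<^sup>2) \<longlonglongrightarrow> 4 * (d + 0)\<^sup>2 - 4 * d\<^sup>2"
      by (intro tendsto_intros LIMSEQ_inverse_real_of_nat)
    then have "\<forall>\<^sub>F n in sequentially. 4 * (d + inverse (real (Suc n)))\<^sup>2 - 4 * d\<^sup>2 < e\<^sup>2"
      by (rule order_tendstoD) (use e in simp)
    then obtain N where N: "4 * (d + inverse (real (Suc N)))\<^sup>2 - 4 * d\<^sup>2 < e\<^sup>2"
      by (auto simp: eventually_sequentially)
    have le: "(norm (g - x n))\<^sup>2 \<le> (d + inverse (real (Suc N)))\<^sup>2" if "N \<le> n" for n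
    proof (rule power_mono)
      have "inverse (real (Suc n)) \<le> inverse (real (Suc N))" using that by (intro le_imp_inverse_le) simp_all
      then show "norm (g - x n) \<le> d + inverse (real (Suc N))" using x[of n] by linarith
    qed simp
    show "\<exists>N. \<forall>m\<ge>N. \<forall>n\<ge>N. dist (x m) (x n) < e"
    proof (intro exI allI impI)
      fix m n assume "N \<le> m" "N \<le> n"
      then have "(norm (x m - x n))\<^sup>2 < e\<^sup>2" using mid[of m n] le[of m] le[of n] N by linarith
      then show "dist (x m) (x n) < e" unfolding dist_norm using e by (simp add: power2_less_imp_less)
    qed
  qed
  then obtain s where s: "s \<in> S" "x \<longlonglongrightarrow> s" using S(2) xS unfolding complete_def by blast
  have "norm (g - s) \<le> d + 0"
  proof (rule LIMSEQ_le)
    show "(\<lambda>n. norm (g - x n)) \<longlonglongrightarrow> norm (g - s)" by (intro tendsto_intros s)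
    show "(\<lambda>n. d + inverse (real (Suc n))) \<longlonglongrightarrow> d + 0" by (intro tendsto_intros LIMSEQ_inverse_real_of_nat)
  qed (use x less_imp_le in blast)
  then have s_min: "norm (g - s) \<le> norm (g - t)" if "t \<in> S" for t using d_le[OF that] by simp
  have "inner f (g - s) = 0" if f: "f \<in> S" for f
  proof (cases "f = 0")
    case False
    \<comment> \<open>This t brings \<open>s + t *\<^sub>R f\<close> closest to g; a non-zero inner
      product would make it closer than s.\<close>
    define t where "t = inner f (g - s) / (norm f)\<^sup>2"
    have "s + t *\<^sub>R f \<in> S" using S(1) s f by (intro subspace_add subspace_scale)
    from s_min[OF this] have "(norm (g - s))\<^sup>2 \<le> (norm (g - s - t *\<^sub>R f))\<^sup>2"
      by (intro power_mono) (simp_all add: diff_diff_eq)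
    also have "\<dots> = (norm (g - s))\<^sup>2 - 2 * t * inner f (g - s) + t\<^sup>2 * (norm f)\<^sup>2"
      unfolding power2_norm_eq_inner
      by (simp add: inner_diff_left inner_diff_right inner_commute power2_eq_square algebra_simps)
    also have "\<dots> = (norm (g - s))\<^sup>2 - (inner f (g - s))\<^sup>2 / (norm f)\<^sup>2"
      using False by (simp add: t_def power2_eq_square field_simps)
    finally have "(inner f (g - s))\<^sup>2 / (norm f)\<^sup>2 \<le> 0" by simp
    then show ?thesis using False by (simp add: divide_le_0_iff)
  qed simp
  then show ?thesis using s(1) by blast
qed

section \<open>The complex inner product\<close>

lemma hardy_mult_minus_1: "hardy_mult (- 1) f = - f"
  by (transfer, simp)

lemma hardy_mult_hardy_mult: "hardy_mult c (hardy_mult b f) = hardy_mult (c * b) f"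
  by (transfer, simp add: mult.assoc)

lemma cip_minus_left: "cip (- f) g = - cip f g"
  using cip_hardy_mult_left[of "- 1" f g] by (simp add: hardy_mult_minus_1)

lemma cip_diff_left: "cip (f - g) h = cip f h - cip g h"
  using cip_add_left[of f "- g" h] by (simp add: cip_minus_left)

lemma cip_0_left [simp]: "cip 0 g = 0"
  by (simp add: cip_def hcoeff_zero)

lemma cip_sum_left: "cip (sum f A) g = (\<Sum>i\<in>A. cip (f i) g)"
  by (induction A rule: infinite_finite_induct) (simp_all add: cip_add_left)

lemma cip_add_right: "cip h (f + g) = cip h f + cip h g"
  by (metis cip_add_left cip_commute complex_cnj_add)

lemma cip_diff_right: "cip h (f - g) = cip h f - cip h g"
  by (metis cip_diff_left cip_commute complex_cnj_diff)

lemma cip_0_right [simp]: "cip g 0 = 0"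
  by (simp add: cip_def hcoeff_zero)

lemma cip_hardy_mult_right: "cip f (hardy_mult c g) = cnj c * cip f g"
  by (metis cip_hardy_mult_left cip_commute complex_cnj_mult)

lemma cip_sum_right: "cip g (sum f A) = (\<Sum>i\<in>A. cip g (f i))"
  by (induction A rule: infinite_finite_induct) (simp_all add: cip_add_right)

lemma cip_self: "cip f f = of_real ((norm f)\<^sup>2)"
proof (rule complex_eqI)
  show "Im (cip f f) = Im (of_real ((norm f)\<^sup>2))"
    using arg_cong[OF cip_commute[of f f], of Im] by simp
qed (simp add: power2_norm_eq_inner inner_hardy2_def)

lemma norm_hardy_mult: "norm (hardy_mult c f) = cmod c * norm f"
proof (rule power2_eq_imp_eq)
  have "cip (hardy_mult c f) (hardy_mult c f) = c * (cnj c * cip f f)"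
    by (simp add: cip_hardy_mult_left cip_hardy_mult_right)
  also have "\<dots> = of_real ((cmod c * norm f)\<^sup>2)"
    by (simp add: cip_self complex_norm_square[symmetric] power_mult_distrib flip: mult.assoc)
  finally have "complex_of_real ((norm (hardy_mult c f))\<^sup>2) = of_real ((cmod c * norm f)\<^sup>2)"
    unfolding cip_self .
  then show "(norm (hardy_mult c f))\<^sup>2 = (cmod c * norm f)\<^sup>2" by (simp only: of_real_eq_iff)
qed simp_all

text \<open>Multiplying f by the unimodular u makes the inner product real and nonnegative, where
  the real Cauchy-Schwarz inequality applies.\<close>

lemma norm_cip_le: "cmod (cip f g) \<le> norm f * norm g"
proof (cases "cip f g = 0")
  case False
  define u where "u = cnj (sgn (cip f g))"
  have u: "cmod u = 1" using False by (simp add: u_def norm_sgn)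
  have "cip (hardy_mult u f) g = of_real (cmod (cip f g))"
    using False by (simp add: cip_hardy_mult_left u_def sgn_div_norm scaleR_conv_of_real complex_norm_square[symmetric]
        power2_eq_square mult.commute[of "cnj _"] mult.assoc)
  then have "cmod (cip f g) = inner (hardy_mult u f) g" by (simp add: inner_hardy2_def)
  also have "\<dots> \<le> norm (hardy_mult u f) * norm g" by (rule norm_cauchy_schwarz)
  finally show ?thesis by (simp add: norm_hardy_mult u)
qed simp

lemma bounded_linear_cip_left: "bounded_linear (\<lambda>f. cip f g)"
proof (rule bounded_linear_intro)
  show "cip (r *\<^sub>R f) g = r *\<^sub>R cip f g" for r f
    by (simp add: scaleR_hardy2_def cip_hardy_mult_left scaleR_conv_of_real)
qed (rule cip_add_left norm_cip_le)+

lemma bounded_linear_hardy_mult: "bounded_linear (hardy_mult c)"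
proof (rule bounded_linear_intro)
  show "hardy_mult c (f + g) = hardy_mult c f + hardy_mult c g" for f g
    by (transfer, simp add: distrib_left)
  show "hardy_mult c (r *\<^sub>R f) = r *\<^sub>R hardy_mult c f" for r f
    by (simp add: scaleR_hardy2_def hardy_mult_hardy_mult mult.commute)
  show "norm (hardy_mult c f) \<le> norm f * cmod c" for f
    by (simp add: norm_hardy_mult mult.commute)
qed

lemma closed_cip_eq_0: "closed {f. cip f g = 0}"
proof -
  have "closed ((\<lambda>f. cip f g) -` {0})"
    by (intro closed_vimage closed_singleton linear_continuous_on bounded_linear_cip_left)
  then show ?thesis by (simp add: vimage_def)
qed

section \<open>Completeness\<close>

lemma hcoeff_diff: "hcoeff (f - g) = (\<lambda>k. hcoeff f k - hcoeff g k)"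
  using hcoeff_add[of f "- g"] hcoeff_hardy_mult[of "- 1" g] by (simp add: hardy_mult_minus_1)

definition hardy_of_coeffs :: "(nat \<times> nat \<Rightarrow> complex) \<Rightarrow> hardy2" where
  "hardy_of_coeffs a = Abs_hardy2 (power_series2 a)"

lemma hcoeff_hardy_of_coeffs: "square_summable a \<Longrightarrow> hcoeff (hardy_of_coeffs a) = a"
  unfolding hardy_of_coeffs_def by (rule hcoeff_eqI) (auto simp: Abs_hardy2_inverse)

lemma sum_hcoeff_le_norm:
  assumes "finite F"
  shows "(\<Sum>k\<in>F. (cmod (hcoeff f k))\<^sup>2) \<le> (norm f)\<^sup>2"
  unfolding norm_hardy2_squared
  using assms square_summable_hcoeff[of f] by (intro finite_sum_le_infsum) (auto simp: square_summable_def)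

text \<open>Coefficients converge one at a time, and the Cauchy bound on finite partial sums passes
  to the limit. This gives square summability of the limit as well as convergence in norm.\<close>

instance hardy2 :: complete_space
proof
  fix X :: "nat \<Rightarrow> hardy2" assume X: "Cauchy X"
  have "Cauchy (\<lambda>n. hcoeff (X n) k)" for k
  proof (rule metric_CauchyI)
    fix e :: real assume "0 < e"
    then obtain N where N: "\<And>m n. m \<ge> N \<Longrightarrow> n \<ge> N \<Longrightarrow> dist (X m) (X n) < e"
      using metric_CauchyD[OF X] by blast
    have "dist (hcoeff (X m) k) (hcoeff (X n) k) \<le> dist (X m) (X n)" for m n
      using sum_hcoeff_le_norm[of "{k}" "X m - X n"] by (simp add: hcoeff_diff dist_norm power2_le_iff_abs_le)
    then show "\<exists>N. \<forall>m\<ge>N. \<forall>n\<ge>N. dist (hcoeff (X m) k) (hcoeff (X n) k) < e"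
      using N by (meson le_less_trans)
  qed
  then have "\<forall>k. \<exists>l. (\<lambda>n. hcoeff (X n) k) \<longlonglongrightarrow> l" by (simp add: Cauchy_convergent_iff convergent_def)
  then obtain a where a: "\<And>k. (\<lambda>n. hcoeff (X n) k) \<longlonglongrightarrow> a k" by metis
  have bound: "(\<Sum>k\<in>F. (cmod (hcoeff (X m) k - a k))\<^sup>2) \<le> e\<^sup>2"
    if "finite F" and N: "\<And>n. N \<le> n \<Longrightarrow> dist (X m) (X n) < e" for F m N e
  proof (rule LIMSEQ_le_const2)
    show "(\<lambda>n. \<Sum>k\<in>F. (cmod (hcoeff (X m) k - hcoeff (X n) k))\<^sup>2) \<longlonglongrightarrow> (\<Sum>k\<in>F. (cmod (hcoeff (X m) k - a k))\<^sup>2)"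
      by (intro tendsto_intros a)
    show "\<exists>N. \<forall>n\<ge>N. (\<Sum>k\<in>F. (cmod (hcoeff (X m) k - hcoeff (X n) k))\<^sup>2) \<le> e\<^sup>2"
    proof (intro exI allI impI)
      fix n assume "N \<le> n"
      then have "(norm (X m - X n))\<^sup>2 \<le> e\<^sup>2" using N[of n] by (intro power_mono) (simp_all add: dist_norm)
      then show "(\<Sum>k\<in>F. (cmod (hcoeff (X m) k - hcoeff (X n) k))\<^sup>2) \<le> e\<^sup>2"
        using sum_hcoeff_le_norm[OF \<open>finite F\<close>, of "X m - X n"] by (simp add: hcoeff_diff)
    qed
  qed
  have summ: "square_summable (\<lambda>k. hcoeff (X m) k - a k)" and sumle: "(\<Sum>\<^sub>\<infinity>k. (cmod (hcoeff (X m) k - a k))\<^sup>2) \<le> e\<^sup>2"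
    if N: "\<And>n. N \<le> n \<Longrightarrow> dist (X m) (X n) < e" for m N e
  proof -
    show "square_summable (\<lambda>k. hcoeff (X m) k - a k)"
      unfolding square_summable_def
      by (rule nonneg_bdd_above_summable_on, simp, rule bdd_aboveI2[where M = "e\<^sup>2"]) (use bound[OF _ N] in blast)
    then show "(\<Sum>\<^sub>\<infinity>k. (cmod (hcoeff (X m) k - a k))\<^sup>2) \<le> e\<^sup>2"
      unfolding square_summable_def by (rule infsum_le_finite_sums) (use bound[OF _ N] in blast)
  qed
  obtain N where "\<And>m n. m \<ge> N \<Longrightarrow> n \<ge> N \<Longrightarrow> dist (X m) (X n) < 1"
    using metric_CauchyD[OF X zero_less_one] by blast
  \<comment> \<open>The limit family is the coefficients of \<open>X N\<close> minus their
    difference from it, and both are square summable.\<close>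
  then have "square_summable (\<lambda>k. hcoeff (X N) k + - 1 * (hcoeff (X N) k - a k))"
    using summ[of N N 1] by (intro square_summable_add square_summable_cmult square_summable_hcoeff) simp
  then have asum: "square_summable a" by simp
  have "X \<longlonglongrightarrow> hardy_of_coeffs a"
  proof (rule metric_LIMSEQ_I)
    fix e :: real assume e: "0 < e"
    obtain N where N: "\<And>m n. m \<ge> N \<Longrightarrow> n \<ge> N \<Longrightarrow> dist (X m) (X n) < e / 2"
      using metric_CauchyD[OF X half_gt_zero[OF e]] by blast
    have "dist (X m) (hardy_of_coeffs a) < e" if "N \<le> m" for m
    proof -
      have "(norm (X m - hardy_of_coeffs a))\<^sup>2 \<le> (e / 2)\<^sup>2"
        unfolding norm_hardy2_squared hcoeff_diff hcoeff_hardy_of_coeffs[OF asum]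
        by (rule sumle[where N = N]) (use N that in blast)
      then have "norm (X m - hardy_of_coeffs a) \<le> e / 2" using e by (simp add: power2_le_iff_abs_le)
      then show ?thesis using e by (simp add: dist_norm)
    qed
    then show "\<exists>N. \<forall>n\<ge>N. dist (X n) (hardy_of_coeffs a) < e" by blast
  qed
  then show "convergent X" by (auto simp: convergent_def)
qed

section \<open>Multiplication by z and w as isometric shifts\<close>

text \<open>By uniqueness of coefficients it is enough to check that moving those of f along h, with
  0 off the range, gives a square summable family representing F. Here h will raise one of the two
  exponents by 1.\<close>

lemma
  assumes h: "inj h" and mono: "\<And>k x. x \<in> bidisc \<Longrightarrow> monomial2 (h k) x = c x * monomial2 k x"
    and F: "Rep_hardy2 F = (\<lambda>x. c x * Rep_hardy2 f x)"
  shows hcoeff_shift: "hcoeff F (h k) = hcoeff f k"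
    and hcoeff_shift_notin_range: "k \<notin> range h \<Longrightarrow> hcoeff F k = 0"
proof -
  define b where "b k = (if k \<in> range h then hcoeff f (inv h k) else 0)" for k
  have bh: "b (h k) = hcoeff f k" for k using h by (simp add: b_def)
  have sum_iff: "((\<lambda>k. u (b k) k) has_sum s) UNIV \<longleftrightarrow> ((\<lambda>k. u (hcoeff f k) (h k)) has_sum s) UNIV"
    if "\<And>k. u 0 k = 0" for u :: "complex \<Rightarrow> nat \<times> nat \<Rightarrow> 'b::{comm_monoid_add,topological_space}" and s
  proof -
    have "((\<lambda>k. u (b k) k) has_sum s) UNIV \<longleftrightarrow> ((\<lambda>k. u (b k) k) has_sum s) (range h)"
      by (intro has_sum_cong_neutral) (auto simp: b_def that)
    also have "\<dots> \<longleftrightarrow> ((\<lambda>k. u (hcoeff f k) (h k)) has_sum s) UNIV"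
      by (subst has_sum_reindex[OF h]) (simp add: o_def bh)
    finally show ?thesis .
  qed
  have "square_summable b"
    using square_summable_hcoeff[of f] sum_iff[of "\<lambda>v k. (cmod v)\<^sup>2"] by (auto simp: square_summable_def summable_on_def)
  moreover have "Rep_hardy2 F = power_series2 b"
  proof (rule power_series2_eqI)
    fix x assume x: "x \<in> bidisc"
    have Fx: "Rep_hardy2 F x = c x * power_series2 (hcoeff f) x" by (simp only: F Rep_hardy2_hcoeff[of f])
    have "((\<lambda>k. hcoeff f k * monomial2 (h k) x) has_sum Rep_hardy2 F x) UNIV"
      using has_sum_cmult_right[OF has_sum_power_series2[OF square_summable_hcoeff x], of "c x" f] mono[OF x]
      by (simp add: mult_ac Fx)
    then show "((\<lambda>k. b k * monomial2 k x) has_sum Rep_hardy2 F x) UNIV"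
      using sum_iff[of "\<lambda>v k. v * monomial2 k x"] by simp
  qed (simp only: F Rep_hardy2_hcoeff[of f], simp add: power_series2_def)
  ultimately have "hcoeff F = b" by (rule hcoeff_eqI)
  then show "hcoeff F (h k) = hcoeff f k" "k \<notin> range h \<Longrightarrow> hcoeff F k = 0"
    by (simp_all add: bh) (simp add: b_def)
qed

lemma hcoeff_mult_z: "hcoeff (mult_z f) (i, j) = (case i of 0 \<Rightarrow> 0 | Suc i' \<Rightarrow> hcoeff f (i', j))"
proof -
  have inj: "inj (\<lambda>k :: nat \<times> nat. (Suc (fst k), snd k))" by (simp add: inj_def prod_eq_iff)
  show ?thesis
    using hcoeff_shift[OF inj _ mult_z.rep_eq, of f "(i - 1, j)"] hcoeff_shift_notin_range[OF inj _ mult_z.rep_eq, of "(i, j)" f]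
    by (auto simp: monomial2_def split: nat.split)
qed

lemma hcoeff_mult_w: "hcoeff (mult_w f) (i, j) = (case j of 0 \<Rightarrow> 0 | Suc j' \<Rightarrow> hcoeff f (i, j'))"
proof -
  have inj: "inj (\<lambda>k :: nat \<times> nat. (fst k, Suc (snd k)))" by (simp add: inj_def prod_eq_iff)
  show ?thesis
    using hcoeff_shift[OF inj _ mult_w.rep_eq, of f "(i, j - 1)"] hcoeff_shift_notin_range[OF inj _ mult_w.rep_eq, of "(i, j)" f]
    by (auto simp: monomial2_def split: nat.split)
qed

lemma cip_shift:
  assumes h: "inj h" and F: "\<And>k. hcoeff F (h k) = hcoeff f k" "\<And>k. k \<notin> range h \<Longrightarrow> hcoeff F k = 0"
    and G: "\<And>k. hcoeff G (h k) = hcoeff g k"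
  shows "cip F G = cip f g"
proof -
  have "((\<lambda>k. hcoeff F k * cnj (hcoeff G k)) has_sum cip f g) (range h)"
    using has_sum_cip[of f g] by (subst has_sum_reindex[OF h]) (simp add: o_def F G)
  then have "((\<lambda>k. hcoeff F k * cnj (hcoeff G k)) has_sum cip f g) UNIV"
    by (subst has_sum_cong_neutral[where T = "range h" and g = "\<lambda>k. hcoeff F k * cnj (hcoeff G k)"]) (auto simp: F(2))
  then show ?thesis by (rule has_sum_unique[OF has_sum_cip])
qed

lemma cip_mult_z [simp]: "cip (mult_z f) (mult_z g) = cip f g"
proof (rule cip_shift)
  show "inj (\<lambda>k :: nat \<times> nat. (Suc (fst k), snd k))" by (simp add: inj_def prod_eq_iff)
  fix k :: "nat \<times> nat" assume "k \<notin> range (\<lambda>k. (Suc (fst k), snd k))"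
  then have "k \<noteq> (Suc i, j)" for i j using rangeI[of "\<lambda>k. (Suc (fst k), snd k)" "(i, j)"] by auto
  then show "hcoeff (mult_z f) k = 0" by (cases k) (auto simp: hcoeff_mult_z split: nat.split)
qed (simp_all add: hcoeff_mult_z)

lemma cip_mult_w [simp]: "cip (mult_w f) (mult_w g) = cip f g"
proof (rule cip_shift)
  show "inj (\<lambda>k :: nat \<times> nat. (fst k, Suc (snd k)))" by (simp add: inj_def prod_eq_iff)
  fix k :: "nat \<times> nat" assume "k \<notin> range (\<lambda>k. (fst k, Suc (snd k)))"
  then have "k \<noteq> (i, Suc j)" for i j using rangeI[of "\<lambda>k. (fst k, Suc (snd k))" "(i, j)"] by auto
  then show "hcoeff (mult_w f) k = 0" by (cases k) (auto simp: hcoeff_mult_w split: nat.split)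
qed (simp_all add: hcoeff_mult_w)

lemma norm_mult_z [simp]: "norm (mult_z f) = norm f"
  by (simp add: norm_eq_sqrt_inner inner_hardy2_def)

lemma norm_mult_w [simp]: "norm (mult_w f) = norm f"
  by (simp add: norm_eq_sqrt_inner inner_hardy2_def)

lemma mult_z_add: "mult_z (f + g) = mult_z f + mult_z g"
  by (transfer, simp add: distrib_left)

lemma mult_w_add: "mult_w (f + g) = mult_w f + mult_w g"
  by (transfer, simp add: distrib_left)

lemma mult_z_hardy_mult: "mult_z (hardy_mult c f) = hardy_mult c (mult_z f)"
  by (transfer, simp add: mult_ac)

lemma mult_w_hardy_mult: "mult_w (hardy_mult c f) = hardy_mult c (mult_w f)"
  by (transfer, simp add: mult_ac)

lemma mult_z_mult_w: "mult_z (mult_w f) = mult_w (mult_z f)"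
  by (transfer, simp add: mult_ac)

lemma bounded_linear_mult_z: "bounded_linear mult_z"
  by (rule bounded_linear_intro[where K = 1])
    (simp_all add: mult_z_add mult_z_hardy_mult scaleR_hardy2_def)

lemma bounded_linear_mult_w: "bounded_linear mult_w"
  by (rule bounded_linear_intro[where K = 1])
    (simp_all add: mult_w_add mult_w_hardy_mult scaleR_hardy2_def)

section \<open>Complex subspaces, the adjoint and orthonormal bases\<close>

text \<open>The type class structure on \<open>hardy2\<close> is real, so complex scalars have to
  enter through \<open>hardy_mult\<close>.\<close>

definition complex_subspace :: "hardy2 set \<Rightarrow> bool" where
  "complex_subspace M \<longleftrightarrow> subspace M \<and> (\<forall>c. \<forall>f\<in>M. hardy_mult c f \<in> M)"

lemma complex_subspaceI:
  assumes "0 \<in> M" "\<And>f g. f \<in> M \<Longrightarrow> g \<in> M \<Longrightarrow> f + g \<in> M" "\<And>c f. f \<in> M \<Longrightarrow> hardy_mult c f \<in> M"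
  shows "complex_subspace M"
  using assms by (auto simp: complex_subspace_def subspace_def scaleR_hardy2_def)

lemma
  assumes "complex_subspace M"
  shows complex_subspace_0: "0 \<in> M"
    and complex_subspace_add: "f \<in> M \<Longrightarrow> g \<in> M \<Longrightarrow> f + g \<in> M"
    and complex_subspace_diff: "f \<in> M \<Longrightarrow> g \<in> M \<Longrightarrow> f - g \<in> M"
    and complex_subspace_hardy_mult: "f \<in> M \<Longrightarrow> hardy_mult c f \<in> M"
  using assms unfolding complex_subspace_def
  by (auto intro: subspace_0 subspace_add subspace_diff)

lemma complex_subspace_closure:
  assumes M: "complex_subspace M"
  shows "complex_subspace (closure M)"
proof (rule complex_subspaceI)
  show "0 \<in> closure M" using complex_subspace_0[OF M] closure_subset by blast
next
  fix f g assume "f \<in> closure M" "g \<in> closure M"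
  then obtain x y where "\<And>n. x n \<in> M" "x \<longlonglongrightarrow> f" "\<And>n. y n \<in> M" "y \<longlonglongrightarrow> g"
    unfolding closure_sequential by blast
  then show "f + g \<in> closure M"
    unfolding closure_sequential
    by (intro exI[of _ "\<lambda>n. x n + y n"]) (auto intro: tendsto_intros complex_subspace_add[OF M])
next
  fix c f assume "f \<in> closure M"
  then show "hardy_mult c f \<in> closure M"
    using closure_bounded_linear_image_subset[OF bounded_linear_hardy_mult, of c M]
      closure_mono[of "hardy_mult c ` M" M] complex_subspace_hardy_mult[OF M] by blast
qed

lemma adjoint_on_mult_z:
  assumes M: "complex_subspace M" "closed M"
  shows adjoint_on_mult_z_in: "adjoint_on M mult_z g \<in> M"
    and cip_adjoint_on_mult_z: "f \<in> M \<Longrightarrow> cip (mult_z f) g = cip f (adjoint_on M mult_z g)"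
proof -
  have sub: "subspace M" using M(1) by (simp add: complex_subspace_def)
  have "complete M" using M(2) by (simp add: complete_eq_closed)
  then have "complete (mult_z ` M)"
    by (intro complete_isometric_image[OF zero_less_one sub bounded_linear_mult_z]) simp_all
  moreover have "subspace (mult_z ` M)"
    using sub bounded_linear_mult_z by (intro linear_subspace_image) (auto simp: bounded_linear.linear)
  ultimately obtain h where h: "h \<in> M" "\<And>f. f \<in> M \<Longrightarrow> inner (mult_z f) (g - mult_z h) = 0"
    using complete_subspace_projection[of "mult_z ` M" g] by auto
  \<comment> \<open>The projection is orthogonal for the real inner product only; testing with \<i>
    times f handles the imaginary part.\<close>
  have "cip (mult_z f) (g - mult_z h) = 0" if f: "f \<in> M" for f
  proof (rule complex_eqI)
    show "Re (cip (mult_z f) (g - mult_z h)) = Re 0"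
      using h(2)[OF f] by (simp add: inner_hardy2_def)
    show "Im (cip (mult_z f) (g - mult_z h)) = Im 0"
      using h(2)[OF complex_subspace_hardy_mult[OF M(1) f, of \<i>]]
      by (simp add: inner_hardy2_def mult_z_hardy_mult cip_hardy_mult_left)
  qed
  then have ex: "h \<in> M \<and> (\<forall>f\<in>M. cip (mult_z f) g = cip f h)"
    using h(1) by (simp add: cip_diff_right)
  have "h' = h" if "h' \<in> M \<and> (\<forall>f\<in>M. cip (mult_z f) g = cip f h')" for h'
  proof -
    have "h' - h \<in> M" using that ex by (intro complex_subspace_diff[OF M(1)]) auto
    then have "cip (h' - h) (h' - h) = 0"
      using that ex by (simp add: cip_diff_right)
    then show ?thesis by (simp add: cip_self)
  qed
  with ex have "adjoint_on M mult_z g \<in> M \<and> (\<forall>f\<in>M. cip (mult_z f) g = cip f (adjoint_on M mult_z g))"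
    unfolding adjoint_on_def by (rule theI)
  then show "adjoint_on M mult_z g \<in> M" "f \<in> M \<Longrightarrow> cip (mult_z f) g = cip f (adjoint_on M mult_z g)"
    by blast+
qed

text \<open>Zorn's lemma gives a maximal orthonormal subset; a non-zero vector of M orthogonal to it
  could be normalized and added. This gives meaning to the basis picked by
  \<open>hs_norm_on\<close>.\<close>

lemma exists_orthonormal_basis:
  assumes M: "complex_subspace M"
  shows "\<exists>B. orthonormal_basis_of M B"
proof -
  define A where "A = {B. B \<subseteq> M \<and> (\<forall>e\<in>B. \<forall>e'\<in>B. cip e e' = (if e = e' then 1 else 0))}"
  have "\<Union>C \<in> A" if "subset.chain A C" for C
  proof -
    have "cip e e' = (if e = e' then 1 else 0)" if "e \<in> X" "X \<in> C" "e' \<in> Y" "Y \<in> C" for e e' X Y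
    proof -
      have "X \<subseteq> Y \<or> Y \<subseteq> X" "X \<in> A" "Y \<in> A"
        using \<open>subset.chain A C\<close> that unfolding subset_chain_def by blast+
      then show ?thesis using that unfolding A_def by blast
    qed
    then show ?thesis using that unfolding A_def subset_chain_def by blast
  qed
  then obtain B where B: "B \<in> A" and max: "\<And>X. X \<in> A \<Longrightarrow> B \<subseteq> X \<Longrightarrow> X = B"
    using subset_Zorn'[of A] by blast
  have "f = 0" if f: "f \<in> M" and orth: "\<forall>e\<in>B. cip f e = 0" for f
  proof (rule ccontr)
    assume "f \<noteq> 0"
    define u where "u = hardy_mult (of_real (inverse (norm f))) f"
    have "cip u u = 1"
      using \<open>f \<noteq> 0\<close> by (simp add: u_def cip_self norm_hardy_mult norm_inverse)
    moreover have "cip u e = 0" "cip e u = 0" if "e \<in> B" for e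
      using orth that cip_commute[of e f] by (simp_all add: u_def cip_hardy_mult_left cip_hardy_mult_right)
    ultimately have u: "cip u u = 1" "\<And>e. e \<in> B \<Longrightarrow> cip u e = 0" "\<And>e. e \<in> B \<Longrightarrow> cip e u = 0"
      by blast+
    have "u \<in> M" unfolding u_def using f by (rule complex_subspace_hardy_mult[OF M])
    then have "insert u B \<in> A" using B u by (auto simp: A_def)
    then have "u \<in> B" using max[of "insert u B"] by blast
    then show False using u by simp
  qed
  then show ?thesis using B unfolding A_def orthonormal_basis_of_def by blast
qed

text \<open>The remainder after projecting to a finite orthonormal family. Its norm yields Bessel's
  inequality, and its product with g drives the Parseval argument in
  \<open>parseval_wandering\<close>.\<close>

lemma
  fixes e :: "'i \<Rightarrow> hardy2" and g :: hardy2
  assumes F: "finite F" and orth: "\<And>i j. i \<in> F \<Longrightarrow> j \<in> F \<Longrightarrow> cip (e i) (e j) = (if i = j then 1 else 0)"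
  defines "r \<equiv> g - (\<Sum>i\<in>F. hardy_mult (cip g (e i)) (e i))"
  shows cip_orthonormal_remainder: "i \<in> F \<Longrightarrow> cip r (e i) = 0"
    and cip_orthonormal_remainder_self: "cip r g = of_real ((norm g)\<^sup>2 - (\<Sum>i\<in>F. (cmod (cip g (e i)))\<^sup>2))"
    and norm_orthonormal_remainder: "(norm r)\<^sup>2 = (norm g)\<^sup>2 - (\<Sum>i\<in>F. (cmod (cip g (e i)))\<^sup>2)"
proof -
  show r0: "cip r (e i) = 0" if "i \<in> F" for i
  proof -
    have "(\<Sum>j\<in>F. cip g (e j) * cip (e j) (e i)) = (\<Sum>j\<in>F. if j = i then cip g (e j) else 0)"
      using that by (intro sum.cong) (simp_all add: orth)
    then show ?thesis using that F by (simp add: r_def cip_diff_left cip_sum_left cip_hardy_mult_left)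
  qed
  show self: "cip r g = of_real ((norm g)\<^sup>2 - (\<Sum>i\<in>F. (cmod (cip g (e i)))\<^sup>2))"
    unfolding r_def cip_diff_left cip_sum_left cip_hardy_mult_left cip_self
    by (simp add: complex_norm_square cip_commute[of "e _" g] del: of_real_power)
  have "cip r r = cip r g"
    using r0 by (subst (2) r_def) (simp add: cip_diff_right cip_sum_right cip_hardy_mult_right)
  then show "(norm r)\<^sup>2 = (norm g)\<^sup>2 - (\<Sum>i\<in>F. (cmod (cip g (e i)))\<^sup>2)"
    unfolding self cip_self by (simp only: of_real_eq_iff)
qed

lemma bessel:
  assumes "finite F" "\<And>i j. i \<in> F \<Longrightarrow> j \<in> F \<Longrightarrow> cip (e i) (e j) = (if i = j then 1 else 0)"
  shows "(\<Sum>i\<in>F. (cmod (cip g (e i)))\<^sup>2) \<le> (norm g)\<^sup>2"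
  using norm_orthonormal_remainder[OF assms, of g] zero_le_power2
  by (metis diff_ge_0_iff_ge)

section \<open>Homogeneous polynomials and orthogonal polynomials on the circle\<close>

lemma hardy_of_poly_add: "hardy_of_poly (p + r) = hardy_of_poly p + hardy_of_poly r"
  by (rule Rep_hardy2_inject[THEN iffD1])
    (auto simp: poly_zw_def fun_eq_iff hardy_of_poly.rep_eq plus_hardy2.rep_eq mult_z.rep_eq mult_w.rep_eq
      hardy_mult.rep_eq zero_hardy2.rep_eq)

lemma hardy_of_poly_pCons_0: "hardy_of_poly (pCons 0 r) = mult_z (hardy_of_poly r)"
  by (rule Rep_hardy2_inject[THEN iffD1])
    (auto simp: poly_zw_def fun_eq_iff hardy_of_poly.rep_eq plus_hardy2.rep_eq mult_z.rep_eq mult_w.rep_eq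
      hardy_mult.rep_eq zero_hardy2.rep_eq)

lemma hardy_of_poly_smult_const: "hardy_of_poly (smult [:c:] r) = hardy_mult c (hardy_of_poly r)"
  by (rule Rep_hardy2_inject[THEN iffD1])
    (auto simp: poly_zw_def fun_eq_iff hardy_of_poly.rep_eq plus_hardy2.rep_eq mult_z.rep_eq mult_w.rep_eq
      hardy_mult.rep_eq zero_hardy2.rep_eq)

lemma hardy_of_poly_smult_pCons_0: "hardy_of_poly (smult (pCons 0 c) r) = mult_w (hardy_of_poly (smult c r))"
  by (rule Rep_hardy2_inject[THEN iffD1])
    (auto simp: poly_zw_def fun_eq_iff hardy_of_poly.rep_eq plus_hardy2.rep_eq mult_z.rep_eq mult_w.rep_eq
      hardy_mult.rep_eq zero_hardy2.rep_eq)

lemma hardy_of_poly_0: "hardy_of_poly 0 = 0"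
  by (rule Rep_hardy2_inject[THEN iffD1])
    (auto simp: poly_zw_def fun_eq_iff hardy_of_poly.rep_eq plus_hardy2.rep_eq mult_z.rep_eq mult_w.rep_eq
      hardy_mult.rep_eq zero_hardy2.rep_eq)

lemma hcoeff_hardy_of_poly: "hcoeff (hardy_of_poly p) (i, j) = coeff (coeff p i) j"
proof -
  define S where "S = (SIGMA i:{..degree p}. {..degree (coeff p i)})"
  define a where "a = (\<lambda>(i, j). coeff (coeff p i) j)"
  have S: "finite S" by (simp add: S_def)
  have a0: "a k = 0" if "k \<notin> S" for k
    using that by (cases k) (auto simp: a_def S_def not_le coeff_eq_0)
  have "square_summable a"
    unfolding square_summable_def
    by (rule has_sum_imp_summable, rule has_sum_finite_neutralI[OF S subset_UNIV _ refl]) (simp add: a0)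
  moreover have "Rep_hardy2 (hardy_of_poly p) = power_series2 a"
  proof (rule power_series2_eqI)
    fix x assume "x \<in> bidisc"
    then have "Rep_hardy2 (hardy_of_poly p) x = (\<Sum>k\<in>S. a k * monomial2 k x)"
      by (simp add: hardy_of_poly.rep_eq poly_zw_sum a_def monomial2_def S_def case_prod_unfold)
    then show "((\<lambda>k. a k * monomial2 k x) has_sum Rep_hardy2 (hardy_of_poly p) x) UNIV"
      by (intro has_sum_finite_neutralI[OF S subset_UNIV]) (simp_all add: a0)
  qed (simp add: hardy_of_poly.rep_eq)
  ultimately have "hcoeff (hardy_of_poly p) = a" by (rule hcoeff_eqI)
  then show ?thesis by (simp add: a_def)
qed

text \<open>\<open>homogenization k s\<close> is the homogeneous polynomial of degree \<open>k\<close> that restricts to \<open>s\<close> on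
  \<open>w = 1\<close>; the coefficients of \<open>s\<close> beyond \<open>k\<close> are cut off.\<close>

definition homogenization :: "nat \<Rightarrow> complex poly \<Rightarrow> hardy2" where
  "homogenization k s = hardy_of_coeffs (\<lambda>(i, j). if i + j = k then coeff s i else 0)"

lemma hcoeff_homogenization: "hcoeff (homogenization k s) (i, j) = (if i + j = k then coeff s i else 0)"
proof -
  have "square_summable (\<lambda>(i, j). if i + j = k then coeff s i else 0)"
    unfolding square_summable_def
    by (rule has_sum_imp_summable, rule has_sum_finite_neutralI[of "{..k} \<times> {..k}", OF _ subset_UNIV _ refl])
      (auto split: if_splits)
  then show ?thesis by (simp add: homogenization_def hcoeff_hardy_of_coeffs)
qed

lemma homogenization_add: "homogenization k (s + t) = homogenization k s + homogenization k t"
  by (intro hardy2_eqI ext) (auto simp: hcoeff_add hcoeff_homogenization)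

lemma homogenization_diff: "homogenization k (s - t) = homogenization k s - homogenization k t"
  by (intro hardy2_eqI ext) (auto simp: hcoeff_diff hcoeff_homogenization)

lemma homogenization_smult: "homogenization k (smult c s) = hardy_mult c (homogenization k s)"
  by (intro hardy2_eqI ext) (auto simp: hcoeff_hardy_mult hcoeff_homogenization)

lemma mult_z_homogenization: "mult_z (homogenization k s) = homogenization (Suc k) (pCons 0 s)"
  by (intro hardy2_eqI ext) (auto simp: hcoeff_mult_z hcoeff_homogenization coeff_pCons split: nat.splits)

text \<open>Without the degree bound, the coefficient of index k + 1 would be cut off on the left
  and present on the right.\<close>

lemma mult_w_homogenization:
  assumes "degree s \<le> k"
  shows "mult_w (homogenization k s) = homogenization (Suc k) s"
  using assms
  by (intro hardy2_eqI ext) (auto simp: hcoeff_mult_w hcoeff_homogenization coeff_eq_0 split: nat.splits)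

lemma cip_homogenization:
  "cip (homogenization k s) (homogenization l t) = (if k = l then \<Sum>i\<le>k. coeff s i * cnj (coeff t i) else 0)"
proof -
  let ?f = "\<lambda>x. hcoeff (homogenization k s) x * cnj (hcoeff (homogenization l t) x)"
  define S where "S = (\<lambda>i. (i, k - i)) ` {..k}"
  have 0: "?f x = 0" if "x \<notin> S" for x
  proof (cases x)
    case (Pair i j)
    have "i + j \<noteq> k"
    proof
      assume "i + j = k"
      then have "x = (i, k - i)" "i \<le> k" by (auto simp: Pair)
      then show False using that by (auto simp: S_def)
    qed
    then show ?thesis by (simp add: Pair hcoeff_homogenization)
  qed
  have "(\<Sum>x\<in>S. ?f x) = (\<Sum>i\<le>k. ?f (i, k - i))"
    unfolding S_def by (subst sum.reindex) (auto simp: inj_on_def)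
  also have "\<dots> = (if k = l then \<Sum>i\<le>k. coeff s i * cnj (coeff t i) else 0)"
    by (auto simp: hcoeff_homogenization intro!: sum.cong sum.neutral)
  finally have "(?f has_sum (if k = l then \<Sum>i\<le>k. coeff s i * cnj (coeff t i) else 0)) UNIV"
    by (intro has_sum_finite_neutralI[of S]) (auto simp: S_def[symmetric] 0, simp add: S_def)
  then show ?thesis by (rule has_sum_unique[OF has_sum_cip])
qed

text \<open>Unlike homogenization, this embedding does not cut off coefficients.\<close>

definition poly_in_z :: "complex poly \<Rightarrow> hardy2" where
  "poly_in_z s = hardy_of_coeffs (\<lambda>(i, j). if j = 0 then coeff s i else 0)"

lemma hcoeff_poly_in_z: "hcoeff (poly_in_z s) (i, j) = (if j = 0 then coeff s i else 0)"
proof -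
  have "square_summable (\<lambda>(i, j). if j = 0 then coeff s i else 0)"
    unfolding square_summable_def
    by (rule has_sum_imp_summable, rule has_sum_finite_neutralI[of "{..degree s} \<times> {0}", OF _ subset_UNIV _ refl])
      (auto intro: le_degree split: if_splits)
  then show ?thesis by (simp add: poly_in_z_def hcoeff_hardy_of_coeffs)
qed

lemma poly_in_z_add: "poly_in_z (s + t) = poly_in_z s + poly_in_z t"
  by (intro hardy2_eqI ext) (auto simp: hcoeff_add hcoeff_poly_in_z)

lemma poly_in_z_diff: "poly_in_z (s - t) = poly_in_z s - poly_in_z t"
  by (intro hardy2_eqI ext) (auto simp: hcoeff_diff hcoeff_poly_in_z)

lemma poly_in_z_smult: "poly_in_z (smult c s) = hardy_mult c (poly_in_z s)"
  by (intro hardy2_eqI ext) (auto simp: hcoeff_hardy_mult hcoeff_poly_in_z)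

lemma poly_in_z_0: "poly_in_z 0 = 0"
  by (intro hardy2_eqI ext) (auto simp: hcoeff_zero hcoeff_poly_in_z)

lemma poly_in_z_sum: "poly_in_z (sum f A) = (\<Sum>i\<in>A. poly_in_z (f i))"
  by (induction A rule: infinite_finite_induct) (simp_all add: poly_in_z_0 poly_in_z_add)

lemma cip_poly_in_z:
  assumes "degree s \<le> k"
  shows "cip (poly_in_z s) (poly_in_z t) = (\<Sum>i\<le>k. coeff s i * cnj (coeff t i))"
proof -
  let ?f = "\<lambda>x. hcoeff (poly_in_z s) x * cnj (hcoeff (poly_in_z t) x)"
  have "?f x = 0" if "x \<notin> (\<lambda>i. (i, 0)) ` {..k}" for x
  proof (cases x)
    case (Pair i j)
    have "coeff s i = 0" if "j = 0"
    proof -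
      have "k < i" using \<open>x \<notin> _\<close> that Pair by (metis atMost_iff image_eqI not_le)
      then show ?thesis using assms by (intro coeff_eq_0) simp
    qed
    then show ?thesis by (auto simp: Pair hcoeff_poly_in_z)
  qed
  moreover have "(\<Sum>x\<in>(\<lambda>i. (i, 0)) ` {..k}. ?f x) = (\<Sum>i\<le>k. coeff s i * cnj (coeff t i))"
    by (subst sum.reindex) (auto simp: inj_on_def hcoeff_poly_in_z)
  ultimately have "(?f has_sum (\<Sum>i\<le>k. coeff s i * cnj (coeff t i))) UNIV"
    by (intro has_sum_finite_neutralI[of "(\<lambda>i. (i, 0)) ` {..k}"]) auto
  then show ?thesis by (rule has_sum_unique[OF has_sum_cip])
qed

text \<open>Restriction to w = 1 is isometric on homogeneous elements, so inner products in any
  degree k are computed by one-variable polynomials.\<close>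

lemma cip_homogenization_eq_cip_poly_in_z:
  "degree s \<le> k \<Longrightarrow> cip (homogenization k s) (homogenization k t) = cip (poly_in_z s) (poly_in_z t)"
  by (simp add: cip_homogenization cip_poly_in_z)

lemma norm_poly_in_z: "(norm (poly_in_z s))\<^sup>2 = (circle_norm2 s)\<^sup>2"
proof -
  have "complex_of_real ((norm (poly_in_z s))\<^sup>2) = complex_of_real ((circle_norm2 s)\<^sup>2)"
    unfolding cip_self[symmetric] cip_poly_in_z[OF order_refl] circle_norm2_square
    by (simp add: complex_norm_square del: of_real_power)
  then show ?thesis by (simp only: of_real_eq_iff)
qed

text \<open>Gram--Schmidt for the measure \<open>\<bar>q\<bar>\<^sup>2 dm\<close>.\<close>

fun monic_op :: "complex poly \<Rightarrow> nat \<Rightarrow> complex poly" where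
  "monic_op q n = monom 1 n - (\<Sum>k<n. smult
     (cip (poly_in_z (q * monom 1 n)) (poly_in_z (q * monic_op q k)) /
      cip (poly_in_z (q * monic_op q k)) (poly_in_z (q * monic_op q k))) (monic_op q k))"

declare monic_op.simps [simp del]

lemma coeff_monic_op: "n \<le> i \<Longrightarrow> coeff (monic_op q n) i = (if i = n then 1 else 0)"
proof (induction n arbitrary: i rule: less_induct)
  case (less n)
  have "coeff (\<Sum>k<n. smult (c k) (monic_op q k)) i = 0" for c
    using less by (simp add: coeff_sum)
  then show ?case by (subst monic_op.simps) (simp add: coeff_diff)
qed

lemma degree_monic_op: "degree (monic_op q n) = n"
  by (rule antisym, rule degree_le) (auto intro!: le_degree simp: coeff_monic_op)

lemma lead_coeff_monic_op: "lead_coeff (monic_op q n) = 1"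
  by (simp add: degree_monic_op coeff_monic_op)

lemma monic_op_neq_0: "monic_op q n \<noteq> 0"
  using lead_coeff_monic_op[of q n] by (metis coeff_0 zero_neq_one)

lemma monic_op_0: "monic_op q 0 = 1"
  by (subst monic_op.simps) simp

lemma poly_in_z_eq_0: "poly_in_z s = 0 \<Longrightarrow> s = 0"
  by (rule poly_eqI) (metis coeff_0 hcoeff_poly_in_z hcoeff_zero)

text \<open>By induction the earlier polynomials are mutually orthogonal, so only the term k = m of
  the subtracted sum survives, and it cancels the contribution of the monomial.\<close>

lemma cip_monic_op:
  assumes "q \<noteq> 0" "m < n"
  shows "cip (poly_in_z (q * monic_op q n)) (poly_in_z (q * monic_op q m)) = 0"
  using \<open>m < n\<close>
proof (induction n arbitrary: m rule: less_induct)
  case (less n)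
  let ?e = "\<lambda>s. poly_in_z (q * s)"
  let ?c = "\<lambda>k. cip (?e (monom 1 n)) (?e (monic_op q k)) / cip (?e (monic_op q k)) (?e (monic_op q k))"
  have ne: "cip (?e (monic_op q m)) (?e (monic_op q m)) \<noteq> 0"
    using poly_in_z_eq_0[of "q * monic_op q m"] assms(1) monic_op_neq_0[of q m] by (auto simp: cip_self)
  have orth: "cip (?e (monic_op q k)) (?e (monic_op q m)) = 0" if "k < n" "k \<noteq> m" for k
  proof (cases "k < m")
    case True
    then have "cip (?e (monic_op q m)) (?e (monic_op q k)) = 0" using less by blast
    then show ?thesis by (subst cip_commute) simp
  next
    case False
    then show ?thesis using less(1)[of k m] that by simp
  qed
  have "?e (monic_op q n) = ?e (monom 1 n) - (\<Sum>k<n. hardy_mult (?c k) (?e (monic_op q k)))"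
    by (subst (1) monic_op.simps) (simp add: right_diff_distrib sum_distrib_left poly_in_z_diff poly_in_z_sum poly_in_z_smult)
  then have "cip (?e (monic_op q n)) (?e (monic_op q m)) =
      cip (?e (monom 1 n)) (?e (monic_op q m)) - (\<Sum>k<n. ?c k * cip (?e (monic_op q k)) (?e (monic_op q m)))"
    by (simp add: cip_diff_left cip_sum_left cip_hardy_mult_left)
  also have "(\<Sum>k<n. ?c k * cip (?e (monic_op q k)) (?e (monic_op q m))) =
      (\<Sum>k<n. if k = m then cip (?e (monom 1 n)) (?e (monic_op q m)) else 0)"
    using orth ne by (intro sum.cong) auto
  finally show ?case using less.prems by simp
qed

text \<open>The top coefficient of s is removed with a monic orthogonal polynomial of lower degree,
  repeatedly. A condition on coefficients in place of a degree bound also fits n = 0, where it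
  forces s = 0.\<close>

lemma cip_monic_op_lower:
  assumes "q \<noteq> 0" and "\<And>i. n \<le> i \<Longrightarrow> coeff s i = 0"
  shows "cip (poly_in_z (q * monic_op q n)) (poly_in_z (q * s)) = 0"
proof -
  have "cip (poly_in_z (q * monic_op q n)) (poly_in_z (q * s)) = 0"
    if "m \<le> n" "\<And>i. m \<le> i \<Longrightarrow> coeff s i = 0" for m s
    using that
  proof (induction m arbitrary: s)
    case 0
    then have "s = 0" by (intro poly_eqI) simp
    then show ?case by (simp add: poly_in_z_0)
  next
    case (Suc m)
    define r where "r = s - smult (coeff s m) (monic_op q m)"
    have "coeff r i = 0" if "m \<le> i" for i
      using that Suc.prems(2)[of i] by (cases "i = m") (auto simp: r_def coeff_monic_op)
    then have "cip (poly_in_z (q * monic_op q n)) (poly_in_z (q * r)) = 0" using Suc by simp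
    moreover have "q * s = smult (coeff s m) (q * monic_op q m) + q * r"
      by (simp add: r_def right_diff_distrib)
    ultimately show ?case
      using cip_monic_op[OF assms(1), of m n] Suc.prems(1)
      by (simp add: poly_in_z_add poly_in_z_smult cip_add_right cip_hardy_mult_right)
  qed
  from this[OF order_refl assms(2)] show ?thesis .
qed

section \<open>The cross commutator of a homogeneous submodule\<close>

text \<open>Here q stands for the restriction of p to w = 1. The degree N of p exceeds that of q
  when w divides p.\<close>

locale homogeneous_generator =
  fixes p :: "complex poly poly" and q :: "complex poly" and N :: nat
  assumes q_neq_0: "q \<noteq> 0" and degree_q: "degree q \<le> N"
    and hardy_of_poly_p: "hardy_of_poly p = homogenization N q"
begin

abbreviation M :: "hardy2 set" where
  "M \<equiv> principal_submodule p"

text \<open>For \<open>degree s \<le> n\<close> this is p times the form of degree n that restricts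
  to s on w = 1.\<close>

definition hom :: "nat \<Rightarrow> complex poly \<Rightarrow> hardy2" where
  "hom n s = homogenization (N + n) (q * s)"

text \<open>Contains all polynomial multiples of p, so a closed condition on \<open>M\<close> can be
  verified on homogeneous elements and their sums (\<open>M_subset\<close>).\<close>

inductive_set hom_span :: "hardy2 set" where
  hom: "degree s \<le> n \<Longrightarrow> hom n s \<in> hom_span"
| add: "f \<in> hom_span \<Longrightarrow> g \<in> hom_span \<Longrightarrow> f + g \<in> hom_span"

lemma degree_q_mult: "degree s \<le> n \<Longrightarrow> degree (q * s) \<le> N + n"
  using degree_mult_le[of q s] degree_q by linarith

lemma hom_add: "hom n (s + t) = hom n s + hom n t"
  by (simp add: hom_def distrib_left homogenization_add)

lemma hom_diff: "hom n (s - t) = hom n s - hom n t"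
  by (simp add: hom_def right_diff_distrib homogenization_diff)

lemma hom_smult: "hom n (smult c s) = hardy_mult c (hom n s)"
  by (simp add: hom_def homogenization_smult)

lemma hom_0: "hom n 0 = 0"
  using hom_diff[of n 0 0] by simp

lemma mult_z_hom: "mult_z (hom n s) = hom (Suc n) (pCons 0 s)"
  by (simp add: hom_def mult_z_homogenization)

lemma mult_w_hom: "degree s \<le> n \<Longrightarrow> mult_w (hom n s) = hom (Suc n) s"
  by (simp add: hom_def mult_w_homogenization degree_q_mult)

lemma cip_hom: "degree s \<le> n \<Longrightarrow> cip (hom n s) (hom n t) = cip (poly_in_z (q * s)) (poly_in_z (q * t))"
  by (simp add: hom_def cip_homogenization_eq_cip_poly_in_z degree_q_mult)

lemma cip_hom_neq: "m \<noteq> n \<Longrightarrow> cip (hom m s) (hom n t) = 0"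
  by (simp add: hom_def cip_homogenization)

lemma hom_1: "hom 0 1 = hardy_of_poly p"
  by (simp add: hom_def hardy_of_poly_p)

lemma hom_span_0: "0 \<in> hom_span"
  using hom_span.hom[of 0 0] by (simp add: hom_0)

lemma hom_span_hardy_mult: "f \<in> hom_span \<Longrightarrow> hardy_mult c f \<in> hom_span"
proof (induction rule: hom_span.induct)
  case (hom s n)
  then have "hom n (smult c s) \<in> hom_span" by (intro hom_span.hom) (simp add: degree_smult_le[THEN order_trans])
  then show ?case by (simp add: hom_smult)
qed (simp add: hom_span.add linear_add[OF bounded_linear.linear[OF bounded_linear_hardy_mult]])

lemma hom_span_mult_z: "f \<in> hom_span \<Longrightarrow> mult_z f \<in> hom_span"
proof (induction rule: hom_span.induct)
  case (hom s n)
  then show ?case unfolding mult_z_hom by (intro hom_span.hom) (simp add: degree_pCons_le[THEN order_trans])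
qed (simp add: hom_span.add mult_z_add)

lemma hom_span_mult_w: "f \<in> hom_span \<Longrightarrow> mult_w f \<in> hom_span"
proof (induction rule: hom_span.induct)
  case (hom s n)
  then show ?case unfolding mult_w_hom[OF hom] by (intro hom_span.hom) simp
qed (simp add: hom_span.add mult_w_add)

lemma range_subset_hom_span: "range (\<lambda>r. hardy_of_poly (p * r)) \<subseteq> hom_span"
proof -
  \<comment> \<open>Multiples of p by polynomials in w alone come first; the induction on r then
    adds powers of z.\<close>
  have smult: "hardy_of_poly (smult c p) \<in> hom_span" for c
  proof (induction c)
    case 0
    then show ?case by (simp add: hardy_of_poly_0 hom_span_0)
  next
    case (pCons a c)
    have "smult (pCons a c) p = smult [:a:] p + smult (pCons 0 c) p"
      by (simp flip: smult_add_left)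
    then have "hardy_of_poly (smult (pCons a c) p) = hardy_mult a (hardy_of_poly p) + mult_w (hardy_of_poly (smult c p))"
      by (simp only: hardy_of_poly_add hardy_of_poly_smult_const hardy_of_poly_smult_pCons_0)
    moreover have "hardy_of_poly p \<in> hom_span" unfolding hom_1[symmetric] by (rule hom_span.hom) simp
    ultimately show ?case using pCons by (simp add: hom_span.add hom_span_mult_w hom_span_hardy_mult)
  qed
  have "hardy_of_poly (p * r) \<in> hom_span" for r
  proof (induction r)
    case 0
    then show ?case by (simp add: hardy_of_poly_0 hom_span_0)
  next
    case (pCons c r)
    then show ?case
      using smult by (simp add: hardy_of_poly_add hardy_of_poly_pCons_0 hom_span.add hom_span_mult_z)
  qed
  then show ?thesis by blast
qed

section \<open>The submodule [p] and its invariance\<close>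

lemma hardy_of_poly_in_M: "hardy_of_poly (p * r) \<in> M"
  unfolding principal_submodule_def by (rule subsetD[OF closure_subset]) (rule rangeI)

lemma closed_M: "closed M"
  by (simp add: principal_submodule_def)

lemma M_subset:
  assumes "closed S" "hom_span \<subseteq> S"
  shows "M \<subseteq> S"
  unfolding principal_submodule_def
  by (rule closure_minimal) (use assms range_subset_hom_span in auto)

lemma complex_subspace_M: "complex_subspace M"
  unfolding principal_submodule_def
proof (rule complex_subspace_closure, rule complex_subspaceI)
  show "0 \<in> range (\<lambda>r. hardy_of_poly (p * r))"
    by (rule image_eqI[of _ _ 0]) (simp_all add: hardy_of_poly_0)
next
  fix f g assume "f \<in> range (\<lambda>r. hardy_of_poly (p * r))" "g \<in> range (\<lambda>r. hardy_of_poly (p * r))"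
  then obtain r s where "f = hardy_of_poly (p * r)" "g = hardy_of_poly (p * s)" by blast
  then have "f + g = hardy_of_poly (p * (r + s))" by (simp add: distrib_left hardy_of_poly_add)
  then show "f + g \<in> range (\<lambda>r. hardy_of_poly (p * r))" by blast
next
  fix c f assume "f \<in> range (\<lambda>r. hardy_of_poly (p * r))"
  then obtain r where "f = hardy_of_poly (p * r)" by blast
  then have "hardy_mult c f = hardy_of_poly (p * smult [:c:] r)"
    by (simp only: mult_smult_right hardy_of_poly_smult_const)
  then show "hardy_mult c f \<in> range (\<lambda>r. hardy_of_poly (p * r))" by blast
qed

lemma M_mult_z: "f \<in> M \<Longrightarrow> mult_z f \<in> M"
proof -
  have "mult_z ` range (\<lambda>r. hardy_of_poly (p * r)) \<subseteq> range (\<lambda>r. hardy_of_poly (p * r))"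
  proof clarify
    fix r
    have "mult_z (hardy_of_poly (p * r)) = hardy_of_poly (p * pCons 0 r)"
      by (simp add: hardy_of_poly_pCons_0)
    then show "mult_z (hardy_of_poly (p * r)) \<in> range (\<lambda>r. hardy_of_poly (p * r))" by blast
  qed
  then show "f \<in> M \<Longrightarrow> mult_z f \<in> M"
    unfolding principal_submodule_def
    using closure_bounded_linear_image_subset[OF bounded_linear_mult_z] closure_mono by blast
qed

lemma M_mult_w: "f \<in> M \<Longrightarrow> mult_w f \<in> M"
proof -
  have "mult_w ` range (\<lambda>r. hardy_of_poly (p * r)) \<subseteq> range (\<lambda>r. hardy_of_poly (p * r))"
  proof clarify
    fix r
    have "smult (pCons 0 1) (p * r) = p * smult (pCons 0 1) r" by simp
    then have "mult_w (hardy_of_poly (p * r)) = hardy_of_poly (p * smult (pCons 0 1) r)"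
      by (metis hardy_of_poly_smult_pCons_0 smult_1_left)
    then show "mult_w (hardy_of_poly (p * r)) \<in> range (\<lambda>r. hardy_of_poly (p * r))" by blast
  qed
  then show "f \<in> M \<Longrightarrow> mult_w f \<in> M"
    unfolding principal_submodule_def
    using closure_bounded_linear_image_subset[OF bounded_linear_mult_w] closure_mono by blast
qed

text \<open>Writing s = a + z s', the element of level n + 1 for s is w times that of level n for
  the constant a, plus z times that of level n for s'.\<close>

lemma hom_in_M: "degree s \<le> n \<Longrightarrow> hom n s \<in> M"
proof (induction n arbitrary: s)
  case 0
  then obtain c where "s = smult c 1" by (metis degree_eq_zeroE le_zero_eq smult_one)
  then have "hom 0 s = hardy_mult c (hardy_of_poly (p * 1))" by (simp only: hom_smult hom_1 mult_1_right)
  then show ?case by (simp only: complex_subspace_hardy_mult[OF complex_subspace_M hardy_of_poly_in_M])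
next
  case (Suc n)
  obtain a s' where s: "s = pCons a s'" by (rule pCons_cases)
  have "degree s' \<le> n" using Suc.prems by (auto simp: s split: if_splits)
  moreover have "s = [:a:] + pCons 0 s'" by (simp add: s)
  then have "hom (Suc n) s = mult_w (hom n [:a:]) + mult_z (hom n s')"
    by (simp only: hom_add mult_z_hom mult_w_hom[of "[:a:]" n] degree_pCons_0 le0)
  ultimately show ?case
    using Suc.IH by (simp add: complex_subspace_add[OF complex_subspace_M] M_mult_w M_mult_z)
qed

section \<open>The orthogonal elements \<Phi> and their norms\<close>

definition \<Phi> :: "nat \<Rightarrow> hardy2" where
  "\<Phi> n = hom n (monic_op q n)"

text \<open>The two monic leading terms cancel, so the difference has degree at most n and can be
  homogenized one level lower than \<open>\<Phi> (Suc n)\<close>; the missing degree is the factor w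
  in \<open>mult_z_\<Phi>\<close>.\<close>

definition \<Psi> :: "nat \<Rightarrow> hardy2" where
  "\<Psi> n = hom n (pCons 0 (monic_op q n) - monic_op q (Suc n))"

lemma degree_diff_monic_op: "degree (pCons 0 (monic_op q n) - monic_op q (Suc n)) \<le> n"
  by (rule degree_le) (auto simp: coeff_monic_op coeff_pCons split: nat.split)

lemma \<Phi>_in_M: "\<Phi> n \<in> M"
  unfolding \<Phi>_def by (rule hom_in_M) (simp add: degree_monic_op)

lemma mult_z_\<Phi>: "mult_z (\<Phi> n) = mult_w (\<Psi> n) + \<Phi> (Suc n)"
proof -
  have "mult_w (\<Psi> n) = hom (Suc n) (pCons 0 (monic_op q n)) - \<Phi> (Suc n)"
    unfolding \<Phi>_def \<Psi>_def mult_w_hom[OF degree_diff_monic_op] by (rule hom_diff)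
  then show ?thesis by (simp add: \<Phi>_def mult_z_hom)
qed

lemma \<Psi>_in_M: "\<Psi> n \<in> M"
  unfolding \<Psi>_def by (rule hom_in_M[OF degree_diff_monic_op])

text \<open>For homogeneous f of level k the product w f has level k + 1. Distinct levels are
  orthogonal, and for n = k + 1 the polynomial s has degree below n. Closedness extends this to all
  of [p].\<close>

lemma cip_mult_w_\<Phi>:
  assumes "f \<in> M"
  shows "cip (mult_w f) (\<Phi> n) = 0"
proof -
  have "cip (\<Phi> n) (mult_w f) = 0" if "f \<in> hom_span" for f
    using that
  proof induction
    case (hom s k)
    show ?case
    proof (cases "n = Suc k")
      case True
      have "cip (poly_in_z (q * monic_op q n)) (poly_in_z (q * s)) = 0"
        using hom True by (intro cip_monic_op_lower q_neq_0) (auto intro: coeff_eq_0)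
      then show ?thesis unfolding \<Phi>_def mult_w_hom[OF hom] True
        by (simp add: cip_hom degree_monic_op)
    qed (simp add: \<Phi>_def mult_w_hom[OF hom] cip_hom_neq)
  qed (simp add: mult_w_add cip_add_right)
  then have "cip (mult_w f) (\<Phi> n) = 0" if "f \<in> hom_span" for f using that by (subst cip_commute) simp
  then have "hom_span \<subseteq> mult_w -` {f. cip f (\<Phi> n) = 0}" by auto
  then have "M \<subseteq> mult_w -` {f. cip f (\<Phi> n) = 0}"
    by (intro M_subset closed_vimage closed_cip_eq_0 linear_continuous_on bounded_linear_mult_w)
  then show ?thesis using assms by auto
qed

lemma cip_\<Phi>_neq: "m \<noteq> n \<Longrightarrow> cip (\<Phi> m) (\<Phi> n) = 0"
  by (simp add: \<Phi>_def cip_hom_neq)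

lemma norm_\<Phi>: "(norm (\<Phi> n))\<^sup>2 = (circle_norm2 (q * monic_op q n))\<^sup>2"
proof -
  have "complex_of_real ((norm (\<Phi> n))\<^sup>2) = complex_of_real ((circle_norm2 (q * monic_op q n))\<^sup>2)"
    unfolding cip_self[symmetric] norm_poly_in_z[symmetric] \<Phi>_def by (simp add: cip_hom degree_monic_op)
  then show ?thesis by (simp only: of_real_eq_iff)
qed

lemma norm_\<Phi>_pos: "0 < (norm (\<Phi> n))\<^sup>2"
  unfolding norm_\<Phi> by (rule circle_norm2_square_pos) (simp add: q_neq_0 monic_op_neq_0)

lemma norm_\<Phi>_ge: "(mahler_measure q)\<^sup>2 \<le> (norm (\<Phi> n))\<^sup>2"
proof -
  have "1 \<le> mahler_measure (monic_op q n)"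
    using lead_coeff_le_mahler_measure[OF monic_op_neq_0, of q n] by (simp only: lead_coeff_monic_op norm_one)
  then have "mahler_measure q \<le> mahler_measure (q * monic_op q n)"
    using mahler_measure_pos[of q] mult_left_mono[of 1 "mahler_measure (monic_op q n)" "mahler_measure q"]
    by (simp add: mahler_measure_mult q_neq_0 monic_op_neq_0)
  then have "(mahler_measure q)\<^sup>2 \<le> (mahler_measure (q * monic_op q n))\<^sup>2"
    using mahler_measure_pos[of q] by (intro power_mono) simp_all
  also have "\<dots> \<le> (circle_norm2 (q * monic_op q n))\<^sup>2"
    by (rule mahler_measure_le_circle_norm2) (simp add: q_neq_0 monic_op_neq_0)
  finally show ?thesis unfolding norm_\<Phi> .
qed

text \<open>Pythagoras for \<open>mult_z_\<Phi>\<close>, multiplication by z and w being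
  isometric.\<close>

lemma norm_\<Psi>: "(norm (\<Psi> n))\<^sup>2 = (norm (\<Phi> n))\<^sup>2 - (norm (\<Phi> (Suc n)))\<^sup>2"
proof -
  have "cip (mult_z (\<Phi> n)) (mult_z (\<Phi> n)) = cip (\<Psi> n) (\<Psi> n) + cip (\<Phi> (Suc n)) (\<Phi> (Suc n))"
    using cip_mult_w_\<Phi>[OF \<Psi>_in_M, of n "Suc n"] cip_commute[of "\<Phi> (Suc n)" "mult_w (\<Psi> n)"]
    unfolding mult_z_\<Phi> cip_add_left cip_add_right by simp
  then have "complex_of_real ((norm (\<Phi> n))\<^sup>2) = complex_of_real ((norm (\<Psi> n))\<^sup>2 + (norm (\<Phi> (Suc n)))\<^sup>2)"
    unfolding cip_mult_z cip_self of_real_add norm_mult_z .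
  then have "(norm (\<Phi> n))\<^sup>2 = (norm (\<Psi> n))\<^sup>2 + (norm (\<Phi> (Suc n)))\<^sup>2" by (simp only: of_real_eq_iff)
  then show ?thesis by simp
qed

lemma sum_norm_\<Psi>_le:
  "(\<Sum>n<K. (norm (\<Psi> n))\<^sup>2 / (norm (\<Phi> n))\<^sup>2) \<le> ln ((circle_norm2 q)\<^sup>2 / (mahler_measure q)\<^sup>2)"
proof -
  let ?a = "\<lambda>n. (norm (\<Phi> n))\<^sup>2"
  note a = norm_\<Phi>_pos
  have step: "(norm (\<Psi> n))\<^sup>2 / ?a n \<le> ln (?a n) - ln (?a (Suc n))" for n
  proof -
    have "ln (?a (Suc n) / ?a n) \<le> ?a (Suc n) / ?a n - 1" by (rule ln_le_minus_one) (simp only: divide_pos_pos a)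
    moreover have "(norm (\<Psi> n))\<^sup>2 / ?a n = 1 - ?a (Suc n) / ?a n"
      unfolding norm_\<Psi> using a[of n] by (simp add: diff_divide_distrib)
    moreover have "ln (?a (Suc n) / ?a n) = ln (?a (Suc n)) - ln (?a n)" by (rule ln_divide_pos[OF a a])
    ultimately show ?thesis by linarith
  qed
  have "(\<Sum>n<K. (norm (\<Psi> n))\<^sup>2 / ?a n) \<le> (\<Sum>n<K. ln (?a n) - ln (?a (Suc n)))"
    by (rule sum_mono) (rule step)
  also have "\<dots> = ln (?a 0) - ln (?a K)" by (rule sum_lessThan_telescope')
  \<comment> \<open>The telescope starts at the norm of q itself, since \<open>monic_op q 0\<close>
    is 1, and ends above the Mahler measure.\<close>
  also have "\<dots> \<le> ln ((circle_norm2 q)\<^sup>2) - ln ((mahler_measure q)\<^sup>2)"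
    using norm_\<Phi>_ge[of K] mahler_measure_pos[of q] norm_\<Phi>[of 0] by (simp add: monic_op_0 ln_mono del: ln_realpow)
  also have "\<dots> = ln ((circle_norm2 q)\<^sup>2 / (mahler_measure q)\<^sup>2)"
    using mahler_measure_pos[of q] circle_norm2_square_pos[OF q_neq_0] by (intro ln_divide_pos[symmetric]) simp_all
  finally show ?thesis .
qed

definition \<phi> :: "nat \<Rightarrow> hardy2" where
  "\<phi> n = hardy_mult (of_real (inverse (norm (\<Phi> n)))) (\<Phi> n)"

lemma cip_\<phi>: "cip (\<phi> m) (\<phi> n) = (if m = n then 1 else 0)"
proof (cases "m = n")
  case True
  then show ?thesis using norm_\<Phi>_pos[of n] by (simp add: \<phi>_def cip_self norm_hardy_mult norm_inverse)
qed (simp add: \<phi>_def cip_hardy_mult_left cip_hardy_mult_right cip_\<Phi>_neq)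

lemma norm_cip_\<phi>: "(cmod (cip g (\<phi> n)))\<^sup>2 = (cmod (cip g (\<Phi> n)))\<^sup>2 / (norm (\<Phi> n))\<^sup>2"
  by (simp add: \<phi>_def cip_hardy_mult_right norm_mult norm_inverse power_mult_distrib power_inverse divide_inverse mult.commute)

section \<open>Parseval's identity on the complement of w[p] in [p]\<close>

text \<open>In other terms, f lies in w[p] plus the span of finitely many \<Phi>: subtracting a
  multiple of \<open>\<Phi> n\<close> from \<open>hom n s\<close> lowers the degree of the
  polynomial, which leaves 0 or a factor w.\<close>

lemma cip_hom_span_eventually_0:
  assumes "f \<in> hom_span"
  shows "\<exists>L. \<forall>u. (\<forall>h\<in>M. cip (mult_w h) u = 0) \<longrightarrow> (\<forall>n<L. cip (\<Phi> n) u = 0) \<longrightarrow> cip f u = 0"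
  using assms
proof induction
  case (hom s n)
  define r where "r = s - smult (coeff s n) (monic_op q n)"
  have s: "hom n s = hardy_mult (coeff s n) (\<Phi> n) + hom n r"
    by (simp add: \<Phi>_def r_def hom_diff hom_smult)
  have r: "coeff r i = 0" if "n \<le> i" for i
    using that hom by (cases "i = n") (auto simp: r_def coeff_monic_op coeff_eq_0)
  have "hom n r = 0 \<or> (\<exists>h\<in>M. hom n r = mult_w h)"
  proof (cases n)
    case 0
    then have "r = 0" using r by (intro poly_eqI) simp
    then show ?thesis by (simp add: hom_0)
  next
    case (Suc m)
    have "degree r \<le> m" using r Suc by (intro degree_le) auto
    then show ?thesis using Suc mult_w_hom hom_in_M by metis
  qed
  then show ?case
    by (intro exI[of _ "Suc n"]) (auto simp: s cip_add_left cip_hardy_mult_left)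
next
  case (add f g)
  then obtain L L' where "\<And>u. (\<forall>h\<in>M. cip (mult_w h) u = 0) \<Longrightarrow> (\<forall>n<L. cip (\<Phi> n) u = 0) \<Longrightarrow> cip f u = 0"
    "\<And>u. (\<forall>h\<in>M. cip (mult_w h) u = 0) \<Longrightarrow> (\<forall>n<L'. cip (\<Phi> n) u = 0) \<Longrightarrow> cip g u = 0"
    by blast
  then show ?case by (intro exI[of _ "max L L'"]) (simp add: cip_add_left)
qed

text \<open>Approximate g by f in \<open>hom_span\<close>. From some K on, the remainder r is
  orthogonal to f, so the defect in Bessel's inequality is <r, g> = <r, g - f>, at most the norm of
  g times the approximation error.\<close>

lemma parseval_wandering:
  assumes g: "g \<in> M" and orth: "\<And>h. h \<in> M \<Longrightarrow> cip (mult_w h) g = 0"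
  shows "(\<lambda>n. (cmod (cip g (\<phi> n)))\<^sup>2) sums (norm g)\<^sup>2"
  unfolding sums_def
proof (rule LIMSEQ_I)
  fix e :: real assume e: "0 < e"
  \<comment> \<open>The added 1 avoids division by 0 for g = 0 and makes
    \<open>norm g * \<delta> < e\<close> strict.\<close>
  define \<delta> where "\<delta> = e / (norm g + 1)"
  have pos: "0 < norm g + 1" using norm_ge_zero[of g] by linarith
  have \<delta>: "0 < \<delta>" unfolding \<delta>_def using e pos by (rule divide_pos_pos)
  have "(norm g + 1) * \<delta> = e" unfolding \<delta>_def using pos by simp
  then have \<delta>_less: "norm g * \<delta> < e" using \<delta> by (simp add: distrib_right)
  have "M \<subseteq> closure hom_span" by (rule M_subset) (simp_all add: closure_subset)
  then obtain f where f: "f \<in> hom_span" "dist f g < \<delta>"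
    using g \<delta> closure_approachable[of g hom_span] by blast
  obtain L where L: "\<And>u. (\<forall>h\<in>M. cip (mult_w h) u = 0) \<Longrightarrow> (\<forall>n<L. cip (\<Phi> n) u = 0) \<Longrightarrow> cip f u = 0"
    using cip_hom_span_eventually_0[OF f(1)] by blast
  show "\<exists>L. \<forall>K\<ge>L. norm ((\<Sum>n<K. (cmod (cip g (\<phi> n)))\<^sup>2) - (norm g)\<^sup>2) < e"
  proof (intro exI allI impI)
    fix K assume K: "L \<le> K"
    let ?S = "\<Sum>n<K. (cmod (cip g (\<phi> n)))\<^sup>2"
    define r where "r = g - (\<Sum>n<K. hardy_mult (cip g (\<phi> n)) (\<phi> n))"
    note rem = cip_orthonormal_remainder[of "{..<K}" \<phi> _ g, OF _ cip_\<phi>, folded r_def]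
      cip_orthonormal_remainder_self[of "{..<K}" \<phi> g, OF _ cip_\<phi>, folded r_def]
      norm_orthonormal_remainder[of "{..<K}" \<phi> g, OF _ cip_\<phi>, folded r_def]
    have "cip (mult_w h) r = 0" if "h \<in> M" for h
      unfolding r_def
      by (simp add: cip_diff_right cip_sum_right cip_hardy_mult_right orth[OF that] \<phi>_def cip_mult_w_\<Phi>[OF that])
    moreover have "cip (\<Phi> n) r = 0" if "n < K" for n
    proof -
      have "cip r (\<phi> n) = 0" using rem(1) that by simp
      then have "cip r (\<Phi> n) = 0" using norm_\<Phi>_pos[of n] by (simp add: \<phi>_def cip_hardy_mult_right)
      then show ?thesis by (subst cip_commute) simp
    qed
    ultimately have "cip f r = 0" using K by (intro L) auto
    then have "cip r f = 0" by (subst cip_commute) simp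
    have S: "0 \<le> ?S" "?S \<le> (norm g)\<^sup>2"
      using rem(3) by (simp_all add: sum_nonneg) (metis diff_ge_0_iff_ge zero_le_power2)
    then have "(norm r)\<^sup>2 \<le> (norm g)\<^sup>2" using rem(3) by simp
    then have "norm r \<le> norm g" by (rule power2_le_imp_le) simp
    have "(norm g)\<^sup>2 - ?S = Re (cip r g)" using rem(2) by simp
    also have "\<dots> = Re (cip r (g - f))" using \<open>cip r f = 0\<close> by (simp add: cip_diff_right)
    also have "\<dots> \<le> norm r * norm (g - f)" using complex_Re_le_cmod norm_cip_le by (rule order_trans)
    also have "\<dots> \<le> norm g * \<delta>"
      using \<open>norm r \<le> norm g\<close> f(2) by (intro mult_mono) (simp_all add: dist_norm norm_minus_commute)
    also have "\<dots> < e" by (rule \<delta>_less)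
    finally show "norm (?S - (norm g)\<^sup>2) < e" using S by simp
  qed
qed

section \<open>Bounding the cross commutator\<close>

lemma cross_commutator_in_M: "f \<in> M \<Longrightarrow> cross_commutator M f \<in> M"
  unfolding cross_commutator_def
  by (intro complex_subspace_diff[OF complex_subspace_M] M_mult_w
      adjoint_on_mult_z_in[OF complex_subspace_M closed_M])

text \<open>Both terms of the commutator pair with w h to <z h, f>: the first as <z w h, w f>, the
  second after cancelling w.\<close>

lemma cip_mult_w_cross_commutator:
  assumes "f \<in> M" "h \<in> M"
  shows "cip (mult_w h) (cross_commutator M f) = 0"
proof -
  note adj = cip_adjoint_on_mult_z[OF complex_subspace_M closed_M]
  show ?thesis
    using adj[OF M_mult_w[OF assms(2)], of "mult_w f"] adj[OF assms(2), of f]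
    by (simp add: cross_commutator_def cip_diff_right mult_z_mult_w)
qed

text \<open>The second term of the commutator lies in w[p] and drops out. The first gives <w f, z
  \<Phi>>, of which only the w \<Psi> part of z \<Phi> contributes.\<close>

lemma cip_cross_commutator_\<Phi>:
  assumes f: "f \<in> M"
  shows "cip (cross_commutator M f) (\<Phi> n) = cip f (\<Psi> n)"
proof -
  have A: "adjoint_on M mult_z f \<in> M" by (rule adjoint_on_mult_z_in[OF complex_subspace_M closed_M])
  have "cip (adjoint_on M mult_z (mult_w f)) (\<Phi> n) = cip (mult_w f) (mult_z (\<Phi> n))"
    using cip_adjoint_on_mult_z[OF complex_subspace_M closed_M \<Phi>_in_M, of n "mult_w f"]
    by (metis cip_commute)
  also have "\<dots> = cip f (\<Psi> n)"
    by (simp add: mult_z_\<Phi> cip_add_right cip_mult_w_\<Phi>[OF f])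
  finally show ?thesis by (simp add: cross_commutator_def cip_diff_left cip_mult_w_\<Phi>[OF A])
qed

text \<open>Truncating Parseval at K leaves two finite sums that can be exchanged; Bessel for
  \<open>\<Psi> n\<close> then bounds the sum over F. The result is independent of K, and of
  F.\<close>

lemma sum_norm_cross_commutator_le:
  assumes F: "finite F" "F \<subseteq> M" and orth: "\<And>e e'. e \<in> F \<Longrightarrow> e' \<in> F \<Longrightarrow> cip e e' = (if e = e' then 1 else 0)"
  shows "(\<Sum>e\<in>F. (norm (cross_commutator M e))\<^sup>2) \<le> ln ((circle_norm2 q)\<^sup>2 / (mahler_measure q)\<^sup>2)"
proof -
  let ?X = "cross_commutator M"
  have "(\<lambda>K. \<Sum>e\<in>F. \<Sum>n<K. (cmod (cip (?X e) (\<phi> n)))\<^sup>2) \<longlonglongrightarrow> (\<Sum>e\<in>F. (norm (?X e))\<^sup>2)"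
  proof (rule tendsto_sum)
    fix e assume "e \<in> F"
    then have "e \<in> M" using F by blast
    then show "(\<lambda>K. \<Sum>n<K. (cmod (cip (?X e) (\<phi> n)))\<^sup>2) \<longlonglongrightarrow> (norm (?X e))\<^sup>2"
      using parseval_wandering[OF cross_commutator_in_M cip_mult_w_cross_commutator] by (simp add: sums_def)
  qed
  moreover have "(\<Sum>e\<in>F. \<Sum>n<K. (cmod (cip (?X e) (\<phi> n)))\<^sup>2) \<le> ln ((circle_norm2 q)\<^sup>2 / (mahler_measure q)\<^sup>2)" for K
  proof -
    have "(\<Sum>e\<in>F. \<Sum>n<K. (cmod (cip (?X e) (\<phi> n)))\<^sup>2) = (\<Sum>n<K. \<Sum>e\<in>F. (cmod (cip (?X e) (\<phi> n)))\<^sup>2)"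
      by (rule sum.swap)
    also have "\<dots> = (\<Sum>n<K. (\<Sum>e\<in>F. (cmod (cip (\<Psi> n) e))\<^sup>2) / (norm (\<Phi> n))\<^sup>2)"
      unfolding sum_divide_distrib
    proof (intro sum.cong refl)
      fix n e assume "e \<in> F"
      then have "cip (?X e) (\<Phi> n) = cnj (cip (\<Psi> n) e)"
        using F by (subst cip_commute[symmetric]) (auto intro: cip_cross_commutator_\<Phi>)
      then show "(cmod (cip (?X e) (\<phi> n)))\<^sup>2 = (cmod (cip (\<Psi> n) e))\<^sup>2 / (norm (\<Phi> n))\<^sup>2"
        by (simp add: norm_cip_\<phi>)
    qed
    also have "\<dots> \<le> (\<Sum>n<K. (norm (\<Psi> n))\<^sup>2 / (norm (\<Phi> n))\<^sup>2)"
      using bessel[of F "\<lambda>e. e"] F orth by (intro sum_mono divide_right_mono) simp_all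
    also have "\<dots> \<le> ln ((circle_norm2 q)\<^sup>2 / (mahler_measure q)\<^sup>2)" by (rule sum_norm_\<Psi>_le)
    finally show ?thesis .
  qed
  ultimately show ?thesis by (intro LIMSEQ_le_const2) blast+
qed

lemma
  assumes B: "orthonormal_basis_of M B"
  shows summable_norm_cross_commutator: "(\<lambda>e. (norm (cross_commutator M e))\<^sup>2) summable_on B"
    and infsum_norm_cross_commutator_le:
      "(\<Sum>\<^sub>\<infinity>e\<in>B. (norm (cross_commutator M e))\<^sup>2) \<le> ln ((circle_norm2 q)\<^sup>2 / (mahler_measure q)\<^sup>2)"
proof -
  have le: "(\<Sum>e\<in>F. (norm (cross_commutator M e))\<^sup>2) \<le> ln ((circle_norm2 q)\<^sup>2 / (mahler_measure q)\<^sup>2)"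
    if F: "finite F" "F \<subseteq> B" for F
  proof (rule sum_norm_cross_commutator_le[OF F(1)])
    show "F \<subseteq> M" using B F(2) unfolding orthonormal_basis_of_def by (meson order_trans)
    show "cip e e' = (if e = e' then 1 else 0)" if "e \<in> F" "e' \<in> F" for e e'
      using B F(2) that unfolding orthonormal_basis_of_def by (meson subsetD)
  qed
  show summable: "(\<lambda>e. (norm (cross_commutator M e))\<^sup>2) summable_on B"
    by (rule nonneg_bdd_above_summable_on, simp, rule bdd_aboveI2[where M = "ln ((circle_norm2 q)\<^sup>2 / (mahler_measure q)\<^sup>2)"])
      (use le in simp)
  show "(\<Sum>\<^sub>\<infinity>e\<in>B. (norm (cross_commutator M e))\<^sup>2) \<le> ln ((circle_norm2 q)\<^sup>2 / (mahler_measure q)\<^sup>2)"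
    by (rule infsum_le_finite_sums[OF summable le])
qed

end

section \<open>Restriction of p to w = 1 and conclusion\<close>

lemma homogeneous_generator_poly_at_w1:
  assumes "p \<noteq> 0" "homogeneous p"
  obtains N where "homogeneous_generator p (poly_at_w1 p) N"
proof -
  obtain N where N: "\<And>i j. coeff (coeff p i) j \<noteq> 0 \<Longrightarrow> i + j = N"
    using assms(2) by (auto simp: homogeneous_def)
  \<comment> \<open>Homogeneity leaves a single power of w next to each power of z, so setting w = 1
    loses no coefficient; in particular the restriction is non-zero.\<close>
  have monom: "coeff p i = (if i \<le> N then monom (coeff (coeff p i) (N - i)) (N - i) else 0)" for i
    using N[of i] by (intro poly_eqI) (force simp: coeff_monom)
  have q: "coeff (poly_at_w1 p) i = (if i \<le> N then coeff (coeff p i) (N - i) else 0)" for i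
    unfolding poly_at_w1_def by (subst coeff_map_poly, simp, subst monom) (simp add: poly_monom)
  have "homogeneous_generator p (poly_at_w1 p) N"
  proof
    show "degree (poly_at_w1 p) \<le> N" by (rule degree_le) (simp add: q)
    show "hardy_of_poly p = homogenization N (poly_at_w1 p)"
    proof (intro hardy2_eqI ext)
      fix k :: "nat \<times> nat"
      obtain i j where k: "k = (i, j)" by (cases k)
      show "hcoeff (hardy_of_poly p) k = hcoeff (homogenization N (poly_at_w1 p)) k"
        using N[of i j] by (auto simp: k hcoeff_hardy_of_poly hcoeff_homogenization q)
    qed
    show "poly_at_w1 p \<noteq> 0"
    proof
      assume "poly_at_w1 p = 0"
      then have "coeff p i = 0" for i using q[of i] by (subst monom) (simp split: if_splits)
      then show False using assms(1) by (simp add: poly_eq_iff)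
    qed
  qed
  then show thesis by (rule that)
qed

theorem theorem4p6:
  fixes p :: "complex poly poly" and d :: nat
  assumes "p \<noteq> 0" and "homogeneous p" and "d = degree (poly_at_w1 p)"
  shows "hilbert_schmidt_on (principal_submodule p) (cross_commutator (principal_submodule p)) \<and>
    (hs_norm_on (principal_submodule p) (cross_commutator (principal_submodule p)))\<^sup>2
      \<le> ln ((circle_norm2 (poly_at_w1 p))\<^sup>2 / (mahler_measure (poly_at_w1 p))\<^sup>2) \<and>
    ln ((circle_norm2 (poly_at_w1 p))\<^sup>2 / (mahler_measure (poly_at_w1 p))\<^sup>2)
      \<le> ln (real ((2 * d) choose d)) \<and>
    (d > 0 \<longrightarrow> ln (real ((2 * d) choose d)) < 2 * real d * ln 2)"
proof -
  let ?M = "principal_submodule p" and ?q = "poly_at_w1 p"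
  let ?X = "cross_commutator ?M"
  obtain N where "homogeneous_generator p ?q N"
    using homogeneous_generator_poly_at_w1[OF assms(1,2)] by blast
  then interpret homogeneous_generator p ?q N .
  \<comment> \<open>The choice inside \<open>hs_norm_on\<close> yields a basis because one exists;
    the bound, valid for every basis, then applies to it.\<close>
  have basis: "orthonormal_basis_of ?M (SOME B. orthonormal_basis_of ?M B)"
    by (rule someI_ex) (rule exists_orthonormal_basis[OF complex_subspace_M])
  have "hilbert_schmidt_on ?M ?X"
    unfolding hilbert_schmidt_on_def using basis summable_norm_cross_commutator by blast
  moreover have "(hs_norm_on ?M ?X)\<^sup>2 \<le> ln ((circle_norm2 ?q)\<^sup>2 / (mahler_measure ?q)\<^sup>2)"
    unfolding hs_norm_on_def using infsum_norm_cross_commutator_le[OF basis]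
    by (simp add: infsum_nonneg)
  moreover have "ln ((circle_norm2 ?q)\<^sup>2 / (mahler_measure ?q)\<^sup>2) \<le> ln (real ((2 * d) choose d))"
  proof (rule ln_mono)
    show "0 < (circle_norm2 ?q)\<^sup>2 / (mahler_measure ?q)\<^sup>2"
      using circle_norm2_square_pos[OF q_neq_0] mahler_measure_pos[of ?q] by simp
    show "(circle_norm2 ?q)\<^sup>2 / (mahler_measure ?q)\<^sup>2 \<le> real ((2 * d) choose d)"
      using circle_norm2_le_mahler_measure[OF q_neq_0] mahler_measure_pos[of ?q] assms(3)
      by (simp add: divide_le_eq)
  qed
  \<comment> \<open>At d = 0 both sides are 0, so strictness needs d > 0.\<close>
  moreover have "ln (real ((2 * d) choose d)) < 2 * real d * ln 2" if "d > 0"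
  proof -
    have "real ((2 * d) choose d) < 4 ^ d"
      using central_binomial_less[OF that] by (metis of_nat_less_iff of_nat_numeral of_nat_power)
    then have "ln (real ((2 * d) choose d)) < ln (4 ^ d)" by (subst ln_less_cancel_iff) simp_all
    also have "ln (4 ^ d :: real) = 2 * real d * ln 2"
      using ln_realpow[of "2 :: real" 2] by (simp add: ln_realpow)
    finally show ?thesis .
  qed
  ultimately show ?thesis by blast
qed

end
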